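(* Let $\mathcal X\subseteq\mathbb R^n$ be a compact convex set, let $r\ge 0$, and let $f\in C^{r+1}(\mathcal X)$ be a convex function attaining its unique minimum over $\mathcal X$ at a point $\mathbf x^\ast\in\mathcal X$ with $\nabla f(\mathbf x^\ast)=\mathbf 0$. Let $\epsilon>0$ and $\eta>0$ be constants, and let the maps $\mathbf g_k:\mathcal X\to\mathbb R^n$ be defined recursively by $$\mathbf g_1(\mathbf x)=-\eta\nabla f(\mathbf x),\qquad \mathbf g_{2k}(\mathbf x)=\mathbf 0,\qquad \mathbf g_{2k+1}(\mathbf x)=-\sum_{\ell=1}^{2k-1}\nabla\mathbf g_\ell(\mathbf x)\,\mathbf g_{2k-\ell}(\mathbf x),\quad k\ge 1 .$$ Then, for every integer $p$ with $0\le p\le r$, the point $\mathbf x=\mathbf x^\ast$ is an asymptotically stable fixed point of the differential equation $$\dot{\mathbf x}=\sum_{k=0}^{p}\epsilon^{2k+1}\mathbf g_{2k+1}(\mathbf x).$$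
   Context: For a vector field $\mathbf g$, $\nabla\mathbf g(\mathbf x)\in\mathbb R^{n\times n}$ denotes its Jacobian matrix. $C^{m}(\mathcal X)$ denotes $m$-times continuously differentiable real functions on $\mathcal X$. Asymptotic stability is meant locally, in the sense of Lyapunov: trajectories starting close to $\mathbf x^\ast$ stay close to it, and trajectories starting sufficiently close to $\mathbf x^\ast$ converge to $\mathbf x^\ast$ as $t\to\infty$. (The equation is the truncation of the flow of $\ddot{\mathbf x}+\mu\dot{\mathbf x}+\eta\nabla f(\mathbf x)=0$ reduced to its slow manifold, with $\epsilon=\mu^{-1}$.) *)

theory Defs
  imports "HOL-Analysis.Analysis"
begin

section \<open>Differentiation on a convex set\<close>

text \<open>
  Derivatives of a map given on a convex set \<open>X\<close> only are taken relative to \<open>X\<close>: one-sided at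
  boundary points, and determined only along the directions of the affine hull of \<open>X\<close>. The gradient
  and the Jacobian matrix are normalised to vanish on the orthogonal complement of these directions,
  which makes them unique; lemmas \<open>gradient_on\<close> and \<open>jacobian_on\<close> show that they exist for every
  map differentiable within \<open>X\<close>. If \<open>X\<close> has interior points, then the space of directions is
  everything and the normalisation is void (\<open>direction_space_eq_UNIV\<close>), and at interior points
  they are the usual ones (\<open>gradient_on_interior\<close>, \<open>jacobian_on_interior\<close>).
\<close>

definition direction_space :: "'a::real_vector set \<Rightarrow> 'a set" where
  "direction_space X = span {y - x |x y. x \<in> X \<and> y \<in> X}"

definition gradient_on :: "(real^'n) set \<Rightarrow> (real^'n \<Rightarrow> real) \<Rightarrow> real^'n \<Rightarrow> real^'n" where
  "gradient_on X f x =
     (THE v. v \<in> direction_space X \<and> (f has_derivative (\<lambda>h. v \<bullet> h)) (at x within X))"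

definition jacobian_on :: "(real^'n) set \<Rightarrow> (real^'n \<Rightarrow> real^'n) \<Rightarrow> real^'n \<Rightarrow> real^'n^'n" where
  "jacobian_on X g x =
     (THE A. (g has_derivative (\<lambda>h. A *v h)) (at x within X) \<and>
             (\<forall>h. (\<forall>v\<in>direction_space X. orthogonal v h) \<longrightarrow> A *v h = 0))"

fun Ck_on :: "nat \<Rightarrow> (real^'n) set \<Rightarrow> (real^'n \<Rightarrow> real) \<Rightarrow> bool" where
  "Ck_on 0 X f \<longleftrightarrow> continuous_on X f"
| "Ck_on (Suc m) X f \<longleftrightarrow>
     f differentiable_on X \<and> (\<forall>i. Ck_on m X (\<lambda>x. gradient_on X f x $ i))"

lemma has_derivative_within_unique_direction_space:
  fixes f :: "'a::real_normed_vector \<Rightarrow> 'b::real_normed_vector"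
  assumes X: "convex X" "x \<in> X"
    and f1: "(f has_derivative f1) (at x within X)" and f2: "(f has_derivative f2) (at x within X)"
    and h: "h \<in> direction_space X"
  shows "f1 h = f2 h"
proof -
  have lin: "linear f1" "linear f2"
    using f1 f2 by (simp_all add: has_derivative_bounded_linear bounded_linear.linear)
  have *: "f1 (y - x) = f2 (y - x)" if y: "y \<in> X" for y
  proof -
    let ?c = "\<lambda>t::real. x + t *\<^sub>R (y - x)"
    have c: "(?c has_derivative (\<lambda>t. t *\<^sub>R (y - x))) (at 0 within {0..1})"
      by (auto intro!: derivative_eq_intros)
    have "?c t \<in> X" if "t \<in> {0..1}" for t
    proof -
      have "?c t = (1 - t) *\<^sub>R x + t *\<^sub>R y" by (simp add: algebra_simps)
      then show ?thesis using convexD[OF X(1) X(2) y, of "1 - t" t] that by simp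
    qed
    then have sub: "?c ` {0..1} \<subseteq> X" by blast
    have comp: "((\<lambda>t. f (?c t)) has_vector_derivative k (y - x)) (at 0 within {0..1})"
      if k: "(f has_derivative k) (at x within X)" for k
    proof -
      have "(f has_derivative k) (at (?c 0) within ?c ` {0..1})"
        using has_derivative_subset[OF k sub] by simp
      from has_derivative_in_compose[OF c this] show ?thesis
        using has_derivative_bounded_linear[OF k]
        by (simp add: has_vector_derivative_def bounded_linear.linear linear_cmul)
    qed
    show ?thesis
      using vector_derivative_unique_within_closed_interval[of 0 1 0] comp[OF f1] comp[OF f2]
      by (simp add: cbox_interval)
  qed
  have "f1 d = f2 d" if "d \<in> {y - z |z y. z \<in> X \<and> y \<in> X}" for d
  proof -
    from that obtain y z where d: "d = (y - x) - (z - x)" and "y \<in> X" "z \<in> X"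
      by (auto simp: algebra_simps)
    then show ?thesis
      unfolding d linear_diff[OF lin(1), of "y - x"] linear_diff[OF lin(2), of "y - x"]
      using *[of y] *[of z] by simp
  qed
  then show ?thesis
    using h unfolding direction_space_def by (rule linear_eq_on_span[OF lin])
qed

lemma direction_space_eq_UNIV:
  fixes X :: "'a::real_normed_vector set"
  assumes "interior X \<noteq> {}"
  shows "direction_space X = UNIV"
proof -
  obtain x e where e: "e > 0" "ball x e \<subseteq> X"
    using assms by (auto simp: mem_interior)
  have "h \<in> direction_space X" for h
  proof (cases "h = 0")
    case True
    then show ?thesis by (simp add: direction_space_def span_zero)
  next
    case False
    let ?c = "e / (2 * norm h)"
    have "x + ?c *\<^sub>R h \<in> ball x e" "x \<in> ball x e" using e False by (auto simp: dist_norm)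
    then have "(x + ?c *\<^sub>R h) - x \<in> direction_space X"
      unfolding direction_space_def using e(2) by (blast intro: span_base)
    then have "?c *\<^sub>R h \<in> direction_space X" by simp
    then have "(1 / ?c) *\<^sub>R (?c *\<^sub>R h) \<in> direction_space X"
      unfolding direction_space_def by (rule span_scale)
    then show ?thesis using e(1) False by simp
  qed
  then show ?thesis by blast
qed

lemma has_derivative_within_cong_direction_space:
  fixes f :: "'a::real_normed_vector \<Rightarrow> 'b::real_normed_vector"
  assumes "x \<in> X" and f1: "(f has_derivative f1) (at x within X)"
    and "bounded_linear f2" and eq: "\<And>h. h \<in> direction_space X \<Longrightarrow> f1 h = f2 h"
  shows "(f has_derivative f2) (at x within X)"
proof -
  have "f1 (y - x) = f2 (y - x)" if "y \<in> X" for y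
    using that \<open>x \<in> X\<close> by (intro eq) (auto simp: direction_space_def intro: span_base)
  then show ?thesis
    using f1 \<open>bounded_linear f2\<close> unfolding has_derivative_within_alt by simp
qed

lemma gradient_on_eqI:
  assumes X: "convex X" "x \<in> X"
    and v: "v \<in> direction_space X" "(f has_derivative (\<lambda>h. v \<bullet> h)) (at x within X)"
  shows "gradient_on X f x = v"
  unfolding gradient_on_def
proof (rule the_equality)
  fix w assume w: "w \<in> direction_space X \<and> (f has_derivative (\<lambda>h. w \<bullet> h)) (at x within X)"
  have "w - v \<in> direction_space X"
    using w v unfolding direction_space_def by (simp add: span_diff)
  then have "w \<bullet> (w - v) = v \<bullet> (w - v)"
    using has_derivative_within_unique_direction_space[OF X, of f "\<lambda>h. w \<bullet> h" "\<lambda>h. v \<bullet> h"] w v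
    by blast
  then have "(w - v) \<bullet> (w - v) = 0" by (simp add: inner_diff_left)
  then show "w = v" by simp
qed (use v in blast)

lemma gradient_on:
  fixes f :: "real^'n \<Rightarrow> real"
  assumes X: "convex X" "x \<in> X" and f: "f differentiable (at x within X)"
  shows "gradient_on X f x \<in> direction_space X"
    and "(f has_derivative (\<lambda>h. gradient_on X f x \<bullet> h)) (at x within X)"
proof -
  obtain L :: "real^'n \<Rightarrow> real" where L: "(f has_derivative L) (at x within X)"
    using f by (auto simp: differentiable_def)
  define w where "w = adjoint L 1"
  have w: "L h = w \<bullet> h" for h
    using adjoint_works[OF bounded_linear.linear[OF has_derivative_bounded_linear[OF L]], of h 1]
    by (simp add: w_def inner_commute)
  obtain v z where v: "v \<in> direction_space X"
    and z: "\<And>h. h \<in> direction_space X \<Longrightarrow> orthogonal z h" and wvz: "w = v + z"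
    unfolding direction_space_def by (rule orthogonal_subspace_decomp_exists) blast
  have "(f has_derivative (\<lambda>h. v \<bullet> h)) (at x within X)"
    using z by (intro has_derivative_within_cong_direction_space[OF X(2) L] bounded_linear_inner_right)
       (simp add: w wvz inner_add_left orthogonal_def)
  moreover from gradient_on_eqI[OF X v this] have "gradient_on X f x = v" .
  ultimately show "gradient_on X f x \<in> direction_space X"
    and "(f has_derivative (\<lambda>h. gradient_on X f x \<bullet> h)) (at x within X)"
    using v by auto
qed

lemma jacobian_on_eqI:
  fixes A :: "real^'n^'n"
  assumes X: "convex X" "x \<in> X" and A: "(g has_derivative (\<lambda>h. A *v h)) (at x within X)"
    "\<And>h. (\<And>v. v \<in> direction_space X \<Longrightarrow> orthogonal v h) \<Longrightarrow> A *v h = 0"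
  shows "jacobian_on X g x = A"
  unfolding jacobian_on_def
proof (rule the_equality)
  fix B :: "real^'n^'n"
  assume B: "(g has_derivative (\<lambda>h. B *v h)) (at x within X) \<and>
    (\<forall>h. (\<forall>v\<in>direction_space X. orthogonal v h) \<longrightarrow> B *v h = 0)"
  have "B *v h = A *v h" for h
  proof -
    obtain v z where v: "v \<in> direction_space X"
      and z: "\<And>h. h \<in> direction_space X \<Longrightarrow> orthogonal z h" and h: "h = v + z"
      unfolding direction_space_def by (rule orthogonal_subspace_decomp_exists) blast
    have "B *v v = A *v v"
      using has_derivative_within_unique_direction_space[OF X, of g "\<lambda>h. B *v h" "\<lambda>h. A *v h"] A B v
      by blast
    moreover have z': "orthogonal u z" if "u \<in> direction_space X" for u
      using z[OF that] by (simp add: orthogonal_def inner_commute)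
    moreover from z' have "B *v z = 0"
      using B by blast
    moreover from z' have "A *v z = 0"
      by (rule A(2))
    ultimately show ?thesis by (simp add: h matrix_vector_right_distrib)
  qed
  then show "B = A" by (simp add: matrix_eq)
qed (use A in blast)

lemma jacobian_on:
  fixes g :: "real^'n \<Rightarrow> real^'n"
  assumes X: "convex X" "x \<in> X" and g: "g differentiable (at x within X)"
  shows "(g has_derivative (\<lambda>h. jacobian_on X g x *v h)) (at x within X)"
    and "(\<And>v. v \<in> direction_space X \<Longrightarrow> orthogonal v h) \<Longrightarrow> jacobian_on X g x *v h = 0"
proof -
  have gi: "(\<lambda>x. g x $ i) differentiable (at x within X)" for i
  proof -
    obtain L where L: "(g has_derivative L) (at x within X)"
      using g by (auto simp: differentiable_def)
    show ?thesis
      using bounded_linear.has_derivative[OF bounded_linear_vec_nth L]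
      unfolding differentiable_def by (intro exI)
  qed
  define A where "A = (\<chi> i. gradient_on X (\<lambda>x. g x $ i) x)"
  have A: "(A *v h) $ i = gradient_on X (\<lambda>x. g x $ i) x \<bullet> h" for h i
    by (simp add: A_def matrix_vector_mul_component)
  have 1: "(g has_derivative (\<lambda>h. A *v h)) (at x within X)"
  proof (subst has_derivative_componentwise_within, intro ballI)
    fix b :: "real^'n" assume "b \<in> Basis"
    then obtain i where b: "b = axis i 1" unfolding Basis_vec_def by auto
    show "((\<lambda>x. g x \<bullet> b) has_derivative (\<lambda>h. (A *v h) \<bullet> b)) (at x within X)"
      using gradient_on(2)[OF X gi[of i]] unfolding b inner_axis A by simp
  qed
  have 2: "A *v h = 0" if "\<And>v. v \<in> direction_space X \<Longrightarrow> orthogonal v h" for h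
  proof -
    have "(A *v h) $ i = 0" for i
      using that[OF gradient_on(1)[OF X gi[of i]]] unfolding A orthogonal_def .
    then show ?thesis by (simp add: vec_eq_iff)
  qed
  have J: "jacobian_on X g x = A" by (rule jacobian_on_eqI[OF X 1 2])
  show "(g has_derivative (\<lambda>h. jacobian_on X g x *v h)) (at x within X)"
    unfolding J by (rule 1)
  show "jacobian_on X g x *v h = 0" if "\<And>v. v \<in> direction_space X \<Longrightarrow> orthogonal v h"
    unfolding J using that by (rule 2)
qed

lemma gradient_on_interior:
  assumes x: "x \<in> interior X" and f: "GDERIV f x :> D"
  shows "gradient_on X f x = D"
proof -
  have *: "direction_space X = UNIV"
    by (rule direction_space_eq_UNIV) (use x in auto)
  have D: "(f has_derivative (\<lambda>h. D \<bullet> h)) (at x)"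
    using f by (simp add: gderiv_def inner_commute)
  have unique: "v = D" if "(f has_derivative (\<lambda>h. v \<bullet> h)) (at x)" for v
  proof -
    have "v \<bullet> h = D \<bullet> h" for h
      using has_derivative_unique[OF that D] by (rule fun_cong)
    then show ?thesis by (rule vector_eq_rdot[THEN iffD1, OF allI])
  qed
  show ?thesis
    unfolding gradient_on_def * at_within_interior[OF x]
  proof (rule the_equality, intro conjI)
    show "(f has_derivative (\<lambda>h. D \<bullet> h)) (at x)" by (rule D)
  qed (simp, erule conjE, rule unique)
qed

lemma jacobian_on_interior:
  assumes x: "x \<in> interior X" and g: "g differentiable (at x)"
  shows "jacobian_on X g x = matrix (frechet_derivative g (at x))"
proof -
  have dir: "direction_space X = UNIV"
    by (rule direction_space_eq_UNIV) (use x in auto)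
  let ?D = "frechet_derivative g (at x)"
  have lin: "linear ?D"
    using g by (rule linear_frechet_derivative)
  have D: "(g has_derivative (\<lambda>h. matrix ?D *v h)) (at x)"
    using g lin by (simp add: matrix_works frechet_derivative_works)
  have ker: "matrix ?D *v h = 0" if "\<forall>v\<in>direction_space X. orthogonal v h" for h
  proof -
    have "orthogonal h h" using that unfolding dir by blast
    then have "h = 0" by (simp only: orthogonal_self)
    then show ?thesis by simp
  qed
  have unique: "A = matrix ?D" if "(g has_derivative (\<lambda>h. A *v h)) (at x)" for A
  proof -
    have "A *v h = matrix ?D *v h" for h
      using has_derivative_unique[OF that D] by (rule fun_cong)
    then show ?thesis by (rule matrix_eq[THEN iffD2, OF allI])
  qed
  show ?thesis
    unfolding jacobian_on_def at_within_interior[OF x]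
  proof (rule the_equality, intro conjI allI impI)
    show "(g has_derivative (\<lambda>h. matrix ?D *v h)) (at x)" by (rule D)
    show "matrix ?D *v h = 0" if "\<forall>v\<in>direction_space X. orthogonal v h" for h
      using that by (rule ker)
  qed (erule conjE, rule unique)
qed

section \<open>Asymptotic stability\<close>

text \<open>
  The right-hand side need not be Lipschitz, so solutions need not be unique; stability and
  attraction are required of all of them. Only trajectories that remain in the domain \<open>X\<close> of the
  vector field are solutions.
\<close>

definition ode_solution_on ::
    "real set \<Rightarrow> 'a::real_normed_vector set \<Rightarrow> ('a \<Rightarrow> 'a) \<Rightarrow> (real \<Rightarrow> 'a) \<Rightarrow> bool" where
  "ode_solution_on J X F u \<longleftrightarrow>
     (\<forall>t\<in>J. u t \<in> X \<and> (u has_vector_derivative F (u t)) (at t within J))"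

definition fixed_point_on :: "'a::real_normed_vector set \<Rightarrow> ('a \<Rightarrow> 'a) \<Rightarrow> 'a \<Rightarrow> bool" where
  "fixed_point_on X F a \<longleftrightarrow> a \<in> X \<and> F a = 0"

definition lyapunov_stable_on :: "'a::real_normed_vector set \<Rightarrow> ('a \<Rightarrow> 'a) \<Rightarrow> 'a \<Rightarrow> bool" where
  "lyapunov_stable_on X F a \<longleftrightarrow>
     (\<forall>e>0. \<exists>d>0. \<forall>u T. ode_solution_on {0..T} X F u \<longrightarrow> dist (u 0) a < d \<longrightarrow>
        (\<forall>t\<in>{0..T}. dist (u t) a < e))"

definition attractive_on :: "'a::real_normed_vector set \<Rightarrow> ('a \<Rightarrow> 'a) \<Rightarrow> 'a \<Rightarrow> bool" where
  "attractive_on X F a \<longleftrightarrow>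
     (\<exists>d>0. \<forall>u. ode_solution_on {0..} X F u \<longrightarrow> dist (u 0) a < d \<longrightarrow> (u \<longlongrightarrow> a) at_top)"

definition asymptotically_stable_on :: "'a::real_normed_vector set \<Rightarrow> ('a \<Rightarrow> 'a) \<Rightarrow> 'a \<Rightarrow> bool" where
  "asymptotically_stable_on X F a \<longleftrightarrow> lyapunov_stable_on X F a \<and> attractive_on X F a"

end

theory Submission
  imports Defs
begin

text \<open>
  The objective \<open>f\<close> is a Lyapunov function near \<open>xs\<close>. Write \<open>G\<close> for the gradient and \<open>H\<close> for the Hessian of \<open>f\<close>.
  By induction, \<open>g (2 * k + 1)\<close> equals \<open>- c\<^sub>k H\<^sup>k G\<close> up to a remainder that is quadratic in \<open>G\<close>: a
  Jacobian lowers the order in \<open>G\<close> by at most one, and every product in the recursion restores it.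
  Here \<open>c\<^sub>k > 0\<close> is \<open>\<eta>\<^sup>k\<^sup>+\<^sup>1\<close> times a Catalan number. As \<open>H\<close> is symmetric and positive semidefinite,
  \<open>G \<bullet> H\<^sup>k G \<ge> 0\<close>, so \<open>f\<close> decreases along trajectories at a rate of at least \<open>\<epsilon> \<eta> |G|\<^sup>2 - K |G|\<^sup>3\<close>, which is
  positive near \<open>xs\<close> even if \<open>H\<close> is degenerate there; \<open>G\<close> vanishes only at \<open>xs\<close> by convexity.
\<close>

section \<open>Orders of vanishing of differentiable functions\<close>

lemma gradient_on_cong:
  assumes "x \<in> X" "\<And>y. y \<in> X \<Longrightarrow> u y = v y"
  shows "gradient_on X u x = gradient_on X v x"
proof -
  have "(u has_derivative D) (at x within X) \<longleftrightarrow> (v has_derivative D) (at x within X)" for D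
    using has_derivative_transform[OF assms(1), of u v D] has_derivative_transform[OF assms(1), of v u D]
      assms(2) by auto
  then show ?thesis by (simp add: gradient_on_def)
qed

lemma gradient_on_const:
  assumes "convex X" "x \<in> X"
  shows "gradient_on X (\<lambda>_. c) x = 0"
  using assms by (intro gradient_on_eqI) (auto simp: direction_space_def span_zero)

lemma gradient_on_add:
  assumes X: "convex X" "x \<in> X"
    and "u differentiable (at x within X)" "v differentiable (at x within X)"
  shows "gradient_on X (\<lambda>y. u y + v y) x = gradient_on X u x + gradient_on X v x"
proof (rule gradient_on_eqI[OF X])
  show "gradient_on X u x + gradient_on X v x \<in> direction_space X"
    using gradient_on(1)[OF X assms(3)] gradient_on(1)[OF X assms(4)]
    by (simp add: direction_space_def span_add)
  show "((\<lambda>y. u y + v y) has_derivative (\<lambda>h. (gradient_on X u x + gradient_on X v x) \<bullet> h))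
      (at x within X)"
    using has_derivative_add[OF gradient_on(2)[OF X assms(3)] gradient_on(2)[OF X assms(4)]]
    by (simp add: inner_add_left)
qed

lemma gradient_on_mult:
  assumes X: "convex X" "x \<in> X"
    and "u differentiable (at x within X)" "v differentiable (at x within X)"
  shows "gradient_on X (\<lambda>y. u y * v y) x = u x *\<^sub>R gradient_on X v x + v x *\<^sub>R gradient_on X u x"
proof (rule gradient_on_eqI[OF X])
  show "u x *\<^sub>R gradient_on X v x + v x *\<^sub>R gradient_on X u x \<in> direction_space X"
    using gradient_on(1)[OF X assms(3)] gradient_on(1)[OF X assms(4)]
    by (simp add: direction_space_def span_add span_scale)
  show "((\<lambda>y. u y * v y) has_derivative
      (\<lambda>h. (u x *\<^sub>R gradient_on X v x + v x *\<^sub>R gradient_on X u x) \<bullet> h)) (at x within X)"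
    using has_derivative_mult[OF gradient_on(2)[OF X assms(3)] gradient_on(2)[OF X assms(4)]]
    by (simp add: inner_add_left algebra_simps)
qed

lemma gradient_on_sum:
  assumes X: "convex X" "x \<in> X" and "finite I"
    and "\<And>i. i \<in> I \<Longrightarrow> u i differentiable (at x within X)"
  shows "gradient_on X (\<lambda>y. \<Sum>i\<in>I. u i y) x = (\<Sum>i\<in>I. gradient_on X (u i) x)"
  using assms(3,4)
proof (induction I rule: finite_induct)
  case empty
  then show ?case using gradient_on_const[OF X] by simp
next
  case (insert i I)
  then show ?case
    using gradient_on_add[OF X, of "u i" "\<lambda>y. \<Sum>i\<in>I. u i y"] by (simp add: differentiable_sum)
qed

lemma differentiable_vec_nth:
  assumes "u differentiable (at x within X)"
  shows "(\<lambda>y. u y $ i) differentiable (at x within X)"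
  using assms bounded_linear.has_derivative[OF bounded_linear_vec_nth]
  unfolding differentiable_def by blast

lemma differentiable_vec_componentwise:
  fixes u :: "real^'n \<Rightarrow> real^'n"
  assumes "\<And>i. (\<lambda>y. u y $ i) differentiable (at x within X)"
  shows "u differentiable (at x within X)"
proof (rule differentiable_componentwise_within[THEN iffD2], intro ballI)
  fix b :: "real^'n" assume "b \<in> Basis"
  then obtain i where "b = axis i 1" unfolding Basis_vec_def by auto
  then show "(\<lambda>y. u y \<bullet> b) differentiable (at x within X)"
    using assms[of i] by (simp add: inner_axis)
qed

text \<open>What needs an argument is that the row lies in \<open>direction_space X\<close>: its
  component \<open>z\<close> orthogonal to that space is annihilated by the Jacobian, so
  \<open>z \<bullet> z = 0\<close>. Uniqueness of the gradient does the rest.\<close>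

lemma jacobian_on_nth:
  assumes X: "convex X" "x \<in> X" and u: "u differentiable (at x within X)"
  shows "jacobian_on X u x $ i = gradient_on X (\<lambda>y. u y $ i) x"
proof -
  let ?J = "jacobian_on X u x"
  have *: "(?J *v h) $ i = ?J $ i \<bullet> h" for h
    by (simp add: matrix_vector_mul_component)
  obtain v z where v: "v \<in> direction_space X"
    and z: "\<And>h. h \<in> direction_space X \<Longrightarrow> orthogonal z h" and vz: "?J $ i = v + z"
    unfolding direction_space_def by (rule orthogonal_subspace_decomp_exists) blast
  have "?J *v z = 0"
    using jacobian_on(2)[OF X u, of z] z by (simp add: orthogonal_commute)
  then have "?J $ i \<bullet> z = 0" using *[of z] by simp
  then have "z \<bullet> z = 0"
    using z[OF v] by (simp add: vz inner_add_left inner_add_right orthogonal_def inner_commute)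
  then have "?J $ i \<in> direction_space X" using v vz by simp
  moreover have "((\<lambda>y. u y $ i) has_derivative (\<lambda>h. ?J $ i \<bullet> h)) (at x within X)"
    using bounded_linear.has_derivative[OF bounded_linear_vec_nth[of i] jacobian_on(1)[OF X u]]
    by (simp add: *)
  ultimately show ?thesis by (intro gradient_on_eqI[OF X, symmetric])
qed

text \<open>\<open>u\<close> is \<open>m\<close> times differentiable and its derivatives of order \<open>j\<close> are \<open>O(w\<^sup>d\<^sup>-\<^sup>j)\<close>,
  bounded for \<open>j \<ge> d\<close> (truncated subtraction).\<close>

fun bigo_Dk :: "(real^'n) set \<Rightarrow> (real^'n \<Rightarrow> real) \<Rightarrow> nat \<Rightarrow> nat \<Rightarrow> (real^'n \<Rightarrow> real) \<Rightarrow> bool" where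
  "bigo_Dk X w 0 d u \<longleftrightarrow> (\<exists>K. \<forall>x\<in>X. \<bar>u x\<bar> \<le> K * w x ^ d)"
| "bigo_Dk X w (Suc m) d u \<longleftrightarrow> u differentiable_on X \<and> (\<exists>K. \<forall>x\<in>X. \<bar>u x\<bar> \<le> K * w x ^ d) \<and>
     (\<forall>i. bigo_Dk X w m (d - 1) (\<lambda>x. gradient_on X u x $ i))"

lemma bigo_Dk_bound:
  assumes "bigo_Dk X w m d u"
  obtains K where "\<And>x. x \<in> X \<Longrightarrow> \<bar>u x\<bar> \<le> K * w x ^ d"
  using assms by (cases m) auto

text \<open>A relative gradient only sees values on \<open>X\<close>. This allows formulas valid
  only on \<open>X\<close>, such as the product rule, to be substituted below further
  gradients.\<close>

lemma bigo_Dk_cong: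
  assumes "\<And>x. x \<in> X \<Longrightarrow> u x = v x"
  shows "bigo_Dk X w m d u \<longleftrightarrow> bigo_Dk X w m d v"
  using assms
proof (induction m arbitrary: d u v)
  case 0
  then show ?case by simp
next
  case (Suc m)
  have "u differentiable_on X \<longleftrightarrow> v differentiable_on X"
    using Suc.prems has_derivative_transform[of _ X u v] has_derivative_transform[of _ X v u]
    unfolding differentiable_on_def differentiable_def by metis
  moreover have "bigo_Dk X w m (d - 1) (\<lambda>x. gradient_on X u x $ i) \<longleftrightarrow>
      bigo_Dk X w m (d - 1) (\<lambda>x. gradient_on X v x $ i)" for i
    using gradient_on_cong[of _ X u v] Suc.prems by (intro Suc.IH) auto
  ultimately show ?case using Suc.prems by simp
qed

text \<open>In the application \<open>w\<close> is the norm of the gradient of the objective: orders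
  are measured in the gradient itself, not in the distance to the minimiser, which is what copes
  with a degenerate Hessian. The bound \<open>W\<close> makes higher orders imply lower
  ones.\<close>

locale bounded_weight =
  fixes X :: "(real^'n) set" and w :: "real^'n \<Rightarrow> real" and W :: real
  assumes X: "compact X" "convex X"
    and w: "\<And>x. x \<in> X \<Longrightarrow> 0 \<le> w x" "\<And>x. x \<in> X \<Longrightarrow> w x \<le> W"
begin

section \<open>Orders of vanishing of scalar functions\<close>

lemma bigo_bound_mono:
  assumes "\<exists>K. \<forall>x\<in>X. \<bar>u x\<bar> \<le> K * w x ^ d" "d' \<le> d"
  shows "\<exists>K. \<forall>x\<in>X. \<bar>u x\<bar> \<le> K * w x ^ d'"
proof -
  obtain K where K: "\<And>x. x \<in> X \<Longrightarrow> \<bar>u x\<bar> \<le> K * w x ^ d" using assms(1) by blast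
  \<comment> \<open>The surplus factor \<open>w x ^ (d - d')\<close> is absorbed into the constant;
    \<open>K\<close> may be negative, hence its absolute value.\<close>
  have "\<bar>u x\<bar> \<le> (\<bar>K\<bar> * \<bar>W\<bar> ^ (d - d')) * w x ^ d'" if x: "x \<in> X" for x
  proof -
    have W: "w x ^ (d - d') \<le> \<bar>W\<bar> ^ (d - d')"
      using w[OF x] by (intro power_mono) auto
    have "w x ^ d = w x ^ (d - d') * w x ^ d'"
      using assms(2) by (simp flip: power_add)
    also have "\<dots> \<le> \<bar>W\<bar> ^ (d - d') * w x ^ d'"
      using W w(1)[OF x] by (intro mult_right_mono) auto
    finally have "\<bar>K\<bar> * w x ^ d \<le> \<bar>K\<bar> * (\<bar>W\<bar> ^ (d - d') * w x ^ d')"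
      by (intro mult_left_mono) auto
    moreover have "K * w x ^ d \<le> \<bar>K\<bar> * w x ^ d"
      using w(1)[OF x] by (intro mult_right_mono) auto
    ultimately show ?thesis using K[OF x] by (simp add: mult.assoc)
  qed
  then show ?thesis by blast
qed

lemma bigo_bound_add:
  assumes "\<exists>K. \<forall>x\<in>X. \<bar>u x\<bar> \<le> K * w x ^ d" "\<exists>K. \<forall>x\<in>X. \<bar>v x\<bar> \<le> K * w x ^ d"
  shows "\<exists>K. \<forall>x\<in>X. \<bar>u x + v x\<bar> \<le> K * w x ^ d"
proof -
  obtain K L where "\<forall>x\<in>X. \<bar>u x\<bar> \<le> K * w x ^ d" "\<forall>x\<in>X. \<bar>v x\<bar> \<le> L * w x ^ d"
    using assms by blast
  then have "\<forall>x\<in>X. \<bar>u x + v x\<bar> \<le> (K + L) * w x ^ d"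
    by (force simp: distrib_right intro: order_trans[OF abs_triangle_ineq])
  then show ?thesis by blast
qed

lemma bigo_bound_mult:
  assumes "\<exists>K. \<forall>x\<in>X. \<bar>u x\<bar> \<le> K * w x ^ d" "\<exists>K. \<forall>x\<in>X. \<bar>v x\<bar> \<le> K * w x ^ e"
  shows "\<exists>K. \<forall>x\<in>X. \<bar>u x * v x\<bar> \<le> K * w x ^ (d + e)"
proof -
  obtain K L where KL: "\<forall>x\<in>X. \<bar>u x\<bar> \<le> K * w x ^ d" "\<forall>x\<in>X. \<bar>v x\<bar> \<le> L * w x ^ e"
    using assms by blast
  have "\<bar>u x * v x\<bar> \<le> (K * L) * w x ^ (d + e)" if x: "x \<in> X" for x
  proof -
    have "\<bar>u x\<bar> * \<bar>v x\<bar> \<le> (K * w x ^ d) * (L * w x ^ e)"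
      using KL x order_trans[OF abs_ge_zero] by (intro mult_mono) auto
    then show ?thesis by (simp add: abs_mult power_add mult_ac)
  qed
  then show ?thesis by blast
qed

lemma bigo_Dk_mono_exponent:
  assumes "bigo_Dk X w m d u" "d' \<le> d"
  shows "bigo_Dk X w m d' u"
  using assms
proof (induction m arbitrary: d d' u)
  case 0
  then show ?case using bigo_bound_mono by simp
next
  case (Suc m)
  have "bigo_Dk X w m (d' - 1) (\<lambda>x. gradient_on X u x $ i)" for i
    using Suc.prems by (intro Suc.IH[of "d - 1" _ "d' - 1"]) auto
  then show ?case using Suc.prems bigo_bound_mono[of u d d'] by auto
qed

lemma bigo_Dk_Suc:
  assumes "bigo_Dk X w (Suc m) d u"
  shows "bigo_Dk X w m d u"
  using assms
proof (induction m arbitrary: d u)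
  case 0
  then show ?case by simp
next
  case (Suc m)
  then show ?case by (metis bigo_Dk.simps(2))
qed

lemma bigo_Dk_mono:
  assumes "bigo_Dk X w m d u" "m' \<le> m" "d' \<le> d"
  shows "bigo_Dk X w m' d' u"
proof -
  have "bigo_Dk X w m' d u"
    using assms(2,1) by (induction m' rule: inc_induct) (auto intro: bigo_Dk_Suc simp del: bigo_Dk.simps)
  then show ?thesis using assms(3) by (rule bigo_Dk_mono_exponent)
qed

lemma bigo_Dk_const: "bigo_Dk X w m 0 (\<lambda>_. c)"
proof (induction m arbitrary: c)
  case 0
  then show ?case by auto
next
  case (Suc m)
  have "bigo_Dk X w m 0 (\<lambda>x. gradient_on X (\<lambda>_. c) x $ i)" for i
    using Suc.IH[of 0] gradient_on_const[OF X(2)]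
    by (subst bigo_Dk_cong[where v = "\<lambda>_. 0"]) auto
  then show ?case by auto
qed

lemma bigo_Dk_add:
  assumes "bigo_Dk X w m d u" "bigo_Dk X w m d v"
  shows "bigo_Dk X w m d (\<lambda>x. u x + v x)"
  using assms
proof (induction m arbitrary: d u v)
  case 0
  then show ?case using bigo_bound_add by simp
next
  case (Suc m)
  have diff: "u differentiable_on X" "v differentiable_on X" using Suc.prems by auto
  have "bigo_Dk X w m (d - 1) (\<lambda>x. gradient_on X (\<lambda>x. u x + v x) x $ i)" for i
  proof (subst bigo_Dk_cong)
    show "gradient_on X (\<lambda>x. u x + v x) x $ i = gradient_on X u x $ i + gradient_on X v x $ i"
      if "x \<in> X" for x
      using gradient_on_add[OF X(2) that] diff that by (simp add: differentiable_on_def)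
    show "bigo_Dk X w m (d - 1) (\<lambda>x. gradient_on X u x $ i + gradient_on X v x $ i)"
      using Suc.prems by (intro Suc.IH) auto
  qed
  then show ?case using Suc.prems diff bigo_bound_add[of u d v] by simp
qed

text \<open>The product rule yields terms of orders \<open>d + (e - 1)\<close> and
  \<open>e + (d - 1)\<close>. With truncated subtraction both are at least \<open>d + e - 1\<close>,
  also if \<open>d\<close> or \<open>e\<close> is 0.\<close>

lemma bigo_Dk_mult:
  assumes "bigo_Dk X w m d u" "bigo_Dk X w m e v"
  shows "bigo_Dk X w m (d + e) (\<lambda>x. u x * v x)"
  using assms
proof (induction m arbitrary: d e u v)
  case 0
  then show ?case using bigo_bound_mult by simp
next
  case (Suc m)
  have diff: "u differentiable_on X" "v differentiable_on X" using Suc.prems by auto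
  have "bigo_Dk X w m (d + e - 1) (\<lambda>x. gradient_on X (\<lambda>x. u x * v x) x $ i)" for i
  proof (subst bigo_Dk_cong)
    show "gradient_on X (\<lambda>x. u x * v x) x $ i =
        u x * gradient_on X v x $ i + v x * gradient_on X u x $ i" if "x \<in> X" for x
      using gradient_on_mult[OF X(2) that] diff that by (simp add: differentiable_on_def)
    have "bigo_Dk X w m (d + (e - 1)) (\<lambda>x. u x * gradient_on X v x $ i)"
      using Suc.prems bigo_Dk_Suc[OF Suc.prems(1)] by (intro Suc.IH) auto
    moreover have "bigo_Dk X w m (e + (d - 1)) (\<lambda>x. v x * gradient_on X u x $ i)"
      using Suc.prems bigo_Dk_Suc[OF Suc.prems(2)] by (intro Suc.IH) auto
    ultimately show "bigo_Dk X w m (d + e - 1)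
        (\<lambda>x. u x * gradient_on X v x $ i + v x * gradient_on X u x $ i)"
      by (intro bigo_Dk_add; elim bigo_Dk_mono_exponent) auto
  qed
  then show ?case using Suc.prems diff bigo_bound_mult[of u d v e] by simp
qed

lemma bigo_Dk_cmult:
  assumes "bigo_Dk X w m d u"
  shows "bigo_Dk X w m d (\<lambda>x. c * u x)"
  using bigo_Dk_mult[OF bigo_Dk_const assms] by simp

text \<open>The order is arbitrary here, which serves the vanishing remainder at the start of the
  recursion.\<close>

lemma bigo_Dk_zero: "bigo_Dk X w m d (\<lambda>_. 0)"
proof (induction m arbitrary: d)
  case 0
  have "\<forall>x\<in>X. \<bar>0\<bar> \<le> 0 * w x ^ d" by simp
  then show ?case unfolding bigo_Dk.simps by blast
next
  case (Suc m)
  have "bigo_Dk X w m (d - 1) (\<lambda>x. gradient_on X (\<lambda>_. 0) x $ i)" for i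
    using Suc.IH[of "d - 1"] gradient_on_const[OF X(2)]
    by (subst bigo_Dk_cong[where v = "\<lambda>_. 0"]) auto
  moreover have "\<forall>x\<in>X. \<bar>0\<bar> \<le> 0 * w x ^ d" by simp
  ultimately show ?case unfolding bigo_Dk.simps by (blast intro: differentiable_on_const)
qed

lemma bigo_Dk_sum:
  assumes "finite I" "\<And>i. i \<in> I \<Longrightarrow> bigo_Dk X w m d (u i)"
  shows "bigo_Dk X w m d (\<lambda>x. \<Sum>i\<in>I. u i x)"
  using assms
  by (induction I rule: finite_induct) (auto intro: bigo_Dk_zero bigo_Dk_add)

text \<open>Continuous functions on a compact set are bounded, and order 0 asks for no more:
  truncated subtraction keeps it at 0 for all derivatives.\<close>

lemma Ck_on_imp_bigo_Dk:
  assumes "Ck_on m X u"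
  shows "bigo_Dk X w m 0 u"
proof -
  have bound: "\<exists>K. \<forall>x\<in>X. \<bar>u x\<bar> \<le> K" if "continuous_on X u" for u :: "real^'n \<Rightarrow> real"
    using compact_imp_bounded[OF compact_continuous_image[OF that X(1)]]
    by (auto simp: bounded_iff)
  show ?thesis
    using assms
  proof (induction m arbitrary: u)
    case 0
    then show ?case using bound by simp
  next
    case (Suc m)
    then show ?case using bound[of u] differentiable_imp_continuous_on[of u X] by auto
  qed
qed

section \<open>Orders of vanishing of vector and matrix fields\<close>

definition bigo_vec :: "nat \<Rightarrow> nat \<Rightarrow> (real^'n \<Rightarrow> real^'n) \<Rightarrow> bool" where
  "bigo_vec m d u \<longleftrightarrow> (\<forall>i. bigo_Dk X w m d (\<lambda>x. u x $ i))"

definition bigo_mat :: "nat \<Rightarrow> nat \<Rightarrow> (real^'n \<Rightarrow> real^'n^'n) \<Rightarrow> bool" where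
  "bigo_mat m d A \<longleftrightarrow> (\<forall>i j. bigo_Dk X w m d (\<lambda>x. A x $ i $ j))"

lemma bigo_vec_cong:
  assumes "\<And>x. x \<in> X \<Longrightarrow> u x = v x"
  shows "bigo_vec m d u \<longleftrightarrow> bigo_vec m d v"
  unfolding bigo_vec_def using assms by (intro all_cong1 bigo_Dk_cong) simp

lemma bigo_mat_cong:
  assumes "\<And>x. x \<in> X \<Longrightarrow> A x = B x"
  shows "bigo_mat m d A \<longleftrightarrow> bigo_mat m d B"
  unfolding bigo_mat_def using assms by (intro all_cong1 bigo_Dk_cong) simp

lemma bigo_vec_mono: "bigo_vec m d u \<Longrightarrow> m' \<le> m \<Longrightarrow> d' \<le> d \<Longrightarrow> bigo_vec m' d' u"
  unfolding bigo_vec_def using bigo_Dk_mono by blast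

lemma bigo_mat_mono: "bigo_mat m d A \<Longrightarrow> m' \<le> m \<Longrightarrow> d' \<le> d \<Longrightarrow> bigo_mat m' d' A"
  unfolding bigo_mat_def using bigo_Dk_mono by blast

lemma bigo_vec_add: "bigo_vec m d u \<Longrightarrow> bigo_vec m d v \<Longrightarrow> bigo_vec m d (\<lambda>x. u x + v x)"
  unfolding bigo_vec_def by (simp add: bigo_Dk_add)

lemma bigo_mat_add: "bigo_mat m d A \<Longrightarrow> bigo_mat m d B \<Longrightarrow> bigo_mat m d (\<lambda>x. A x + B x)"
  unfolding bigo_mat_def by (simp add: bigo_Dk_add)

lemma bigo_vec_scaleR: "bigo_vec m d u \<Longrightarrow> bigo_vec m d (\<lambda>x. c *\<^sub>R u x)"
  unfolding bigo_vec_def by (simp add: bigo_Dk_cmult)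

lemma bigo_mat_scaleR: "bigo_mat m d A \<Longrightarrow> bigo_mat m d (\<lambda>x. c *\<^sub>R A x)"
  unfolding bigo_mat_def by (simp add: bigo_Dk_cmult)

lemma bigo_vec_sum:
  "finite I \<Longrightarrow> (\<And>i. i \<in> I \<Longrightarrow> bigo_vec m d (u i)) \<Longrightarrow> bigo_vec m d (\<lambda>x. \<Sum>i\<in>I. u i x)"
  unfolding bigo_vec_def by (simp add: bigo_Dk_sum)

lemma bigo_mat_const: "bigo_mat m 0 (\<lambda>_. A)"
  unfolding bigo_mat_def by (simp add: bigo_Dk_const)

lemma bigo_mat_mult:
  "bigo_mat m d A \<Longrightarrow> bigo_mat m e B \<Longrightarrow> bigo_mat m (d + e) (\<lambda>x. A x ** B x)"
  unfolding bigo_mat_def matrix_matrix_mult_def by (simp add: bigo_Dk_sum bigo_Dk_mult)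

lemma bigo_mat_vec_mult:
  "bigo_mat m d A \<Longrightarrow> bigo_vec m e u \<Longrightarrow> bigo_vec m (d + e) (\<lambda>x. A x *v u x)"
  unfolding bigo_mat_def bigo_vec_def matrix_vector_mult_def by (simp add: bigo_Dk_sum bigo_Dk_mult)

lemma bigo_vec_differentiable:
  assumes "bigo_vec (Suc m) d u" "x \<in> X"
  shows "u differentiable (at x within X)"
  using assms by (intro differentiable_vec_componentwise)
    (auto simp: bigo_vec_def differentiable_on_def)

text \<open>Rows of a Jacobian are gradients, and a gradient costs one derivative and at most one
  order.\<close>

lemma bigo_mat_jacobian:
  assumes "bigo_vec (Suc m) d u"
  shows "bigo_mat m (d - 1) (jacobian_on X u)"
  unfolding bigo_mat_def
proof (intro allI)
  fix i j
  have "bigo_Dk X w m (d - 1) (\<lambda>x. gradient_on X (\<lambda>y. u y $ i) x $ j)"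
    using assms by (simp add: bigo_vec_def)
  then show "bigo_Dk X w m (d - 1) (\<lambda>x. jacobian_on X u x $ i $ j)"
    using jacobian_on_nth[OF X(2)] bigo_vec_differentiable[OF assms]
    by (subst bigo_Dk_cong) auto
qed

text \<open>By the Leibniz rule the difference consists of the terms in which the derivative falls
  on \<open>A\<close>. They keep an undifferentiated factor \<open>u\<close> and hence its order
  1.\<close>

lemma bigo_mat_jacobian_mult:
  assumes A: "bigo_mat (Suc m) 0 A" and u: "bigo_vec (Suc m) 1 u"
  shows "bigo_mat m 1 (\<lambda>x. jacobian_on X (\<lambda>x. A x *v u x) x - A x ** jacobian_on X u x)"
  unfolding bigo_mat_def
proof (intro allI)
  fix i j
  have du: "u differentiable (at x within X)" if "x \<in> X" for x
    using bigo_vec_differentiable[OF u that] .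
  have dA: "(\<lambda>x. A x $ i $ k) differentiable (at x within X)" if "x \<in> X" for x k
    using A that by (auto simp: bigo_mat_def differentiable_on_def)
  have dAu: "(\<lambda>x. A x *v u x) differentiable (at x within X)" if "x \<in> X" for x
    using bigo_vec_differentiable[OF bigo_mat_vec_mult[OF A u] that] .
  have "bigo_Dk X w m (1 + 0) (\<lambda>x. u x $ k * gradient_on X (\<lambda>x. A x $ i $ k) x $ j)" for k
  proof (rule bigo_Dk_mult)
    show "bigo_Dk X w m 1 (\<lambda>x. u x $ k)"
      using u bigo_Dk_Suc by (auto simp: bigo_vec_def)
    show "bigo_Dk X w m 0 (\<lambda>x. gradient_on X (\<lambda>x. A x $ i $ k) x $ j)"
      using A by (auto simp: bigo_mat_def)
  qed
  then have *: "bigo_Dk X w m 1 (\<lambda>x. \<Sum>k\<in>UNIV. u x $ k * gradient_on X (\<lambda>x. A x $ i $ k) x $ j)"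
    by (intro bigo_Dk_sum) auto
  show "bigo_Dk X w m 1 (\<lambda>x. (jacobian_on X (\<lambda>x. A x *v u x) x - A x ** jacobian_on X u x) $ i $ j)"
  proof (rule bigo_Dk_cong[THEN iffD1, OF _ *])
    fix x assume x: "x \<in> X"
    have "jacobian_on X (\<lambda>x. A x *v u x) x $ i = gradient_on X (\<lambda>x. \<Sum>k\<in>UNIV. A x $ i $ k * u x $ k) x"
      using jacobian_on_nth[OF X(2) x dAu[OF x], of i] by (simp add: matrix_vector_mult_def)
    also have "\<dots> = (\<Sum>k\<in>UNIV. gradient_on X (\<lambda>x. A x $ i $ k * u x $ k) x)"
      using X(2) x dA[OF x] differentiable_vec_nth[OF du[OF x]]
      by (intro gradient_on_sum differentiable_mult) auto
    also have "\<dots> = (\<Sum>k\<in>UNIV. A x $ i $ k *\<^sub>R gradient_on X (\<lambda>x. u x $ k) x +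
        u x $ k *\<^sub>R gradient_on X (\<lambda>x. A x $ i $ k) x)"
      using X(2) x dA[OF x] differentiable_vec_nth[OF du[OF x]]
      by (intro sum.cong gradient_on_mult) auto
    finally show "(\<Sum>k\<in>UNIV. u x $ k * gradient_on X (\<lambda>x. A x $ i $ k) x $ j) =
        (jacobian_on X (\<lambda>x. A x *v u x) x - A x ** jacobian_on X u x) $ i $ j"
      by (simp add: matrix_matrix_mult_def jacobian_on_nth[OF X(2) x du[OF x]] sum.distrib)
  qed
qed

end

section \<open>The Hessian of a convex function\<close>

text \<open>As \<open>S\<close> parametrises points of \<open>X\<close> only, this chain rule serves
  at boundary points of \<open>X\<close> too.\<close>

lemma has_derivative_along_segment:
  fixes f :: "'a::real_normed_vector \<Rightarrow> 'b::real_normed_vector"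
  assumes f: "(f has_derivative D) (at (a + t *\<^sub>R u) within X)"
    and sub: "\<And>s. s \<in> S \<Longrightarrow> a + s *\<^sub>R u \<in> X"
  shows "((\<lambda>s. f (a + s *\<^sub>R u)) has_derivative (\<lambda>h. D (h *\<^sub>R u))) (at t within S)"
proof -
  have "((\<lambda>s. a + s *\<^sub>R u) has_derivative (\<lambda>h. h *\<^sub>R u)) (at t within S)"
    by (auto intro!: derivative_eq_intros)
  moreover have "(f has_derivative D) (at (a + t *\<^sub>R u) within (\<lambda>s. a + s *\<^sub>R u) ` S)"
    by (rule has_derivative_subset[OF f]) (use sub in auto)
  ultimately show ?thesis by (rule has_derivative_in_compose)
qed

text \<open>By convexity the difference quotients of \<open>f\<close> along the segment from
  \<open>x\<close> to \<open>y\<close> are at most \<open>f y - f x\<close>; their limit at 0 is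
  \<open>D (y - x)\<close>.\<close>

lemma convex_on_gradient_inequality:
  fixes f :: "'a::real_normed_vector \<Rightarrow> real"
  assumes f: "convex_on X f" and x: "x \<in> X" and y: "y \<in> X"
    and D: "(f has_derivative D) (at x within X)"
  shows "D (y - x) \<le> f y - f x"
proof -
  let ?c = "\<lambda>t::real. x + t *\<^sub>R (y - x)"
  have X: "convex X" using f by (rule convex_on_imp_convex)
  have c: "?c t = (1 - t) *\<^sub>R x + t *\<^sub>R y" for t by (simp add: algebra_simps)
  have cX: "?c t \<in> X" if "t \<in> {0..1}" for t
    unfolding c using convexD[OF X x y, of "1 - t" t] that by simp
  have "((\<lambda>t. f (?c t)) has_derivative (\<lambda>t. D (t *\<^sub>R (y - x)))) (at 0 within {0..1})"
    using D cX by (intro has_derivative_along_segment[where X = X]) auto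
  moreover have "D (t *\<^sub>R (y - x)) = D (y - x) * t" for t
    using has_derivative_bounded_linear[OF D]
    by (simp add: bounded_linear.linear linear_cmul)
  ultimately have "((\<lambda>t. f (?c t)) has_field_derivative D (y - x)) (at 0 within {0..1})"
    by (simp add: has_field_derivative_def mult_commute_abs)
  then have "((\<lambda>t. (f (?c t) - f x) / t) \<longlongrightarrow> D (y - x)) (at 0 within {0..1})"
    by (simp add: has_field_derivative_iff)
  moreover have "\<forall>\<^sub>F t in at 0 within {0..1}. (f (?c t) - f x) / t \<le> f y - f x"
  proof (unfold eventually_at_filter, intro always_eventually allI impI)
    fix t :: real assume t: "t \<noteq> 0" "t \<in> {0..1}"
    then have "f (?c t) \<le> (1 - t) * f x + t * f y"
      unfolding c using f x y by (auto simp: convex_on_def)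
    then show "(f (?c t) - f x) / t \<le> f y - f x"
      using t by (simp add: divide_simps algebra_simps)
  qed
  moreover have "at (0::real) within {0..1} \<noteq> bot" by (simp add: at_within_Icc_at_right)
  ultimately show ?thesis using tendsto_upperbound by blast
qed

section \<open>Symmetry of the second derivative\<close>

lemma convex_add_scaleR_add_scaleR_mem:
  fixes X :: "'a::real_vector set"
  assumes X: "convex X" "x \<in> X" "x + u \<in> X" "x + v \<in> X"
    and ab: "0 \<le> a" "a \<le> 1/2" "0 \<le> b" "b \<le> 1/2"
  shows "x + a *\<^sub>R u + b *\<^sub>R v \<in> X"
proof -
  have 1: "(1 - 2 * a) *\<^sub>R x + (2 * a) *\<^sub>R (x + u) \<in> X"
    using convexD[OF X(1,2,3), of "1 - 2 * a" "2 * a"] ab by simp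
  have 2: "(1 - 2 * b) *\<^sub>R x + (2 * b) *\<^sub>R (x + v) \<in> X"
    using convexD[OF X(1,2,4), of "1 - 2 * b" "2 * b"] ab by simp
  \<comment> \<open>The point is the midpoint of \<open>x + (2 * a) *\<^sub>R u\<close> and
    \<open>x + (2 * b) *\<^sub>R v\<close>, both on segments inside \<open>X\<close>; hence the
    bound 1/2.\<close>
  have "(1/2) *\<^sub>R ((1 - 2 * a) *\<^sub>R x + (2 * a) *\<^sub>R (x + u)) +
      (1/2) *\<^sub>R ((1 - 2 * b) *\<^sub>R x + (2 * b) *\<^sub>R (x + v)) = x + a *\<^sub>R u + b *\<^sub>R v"
    by (simp add: algebra_simps flip: scaleR_left_distrib)
  then show ?thesis using convexD[OF X(1) 1 2, of "1/2" "1/2"] by simp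
qed

text \<open>Young's argument, valid at boundary points of \<open>X\<close> too: the second difference of \<open>f\<close> is symmetric
  in \<open>u\<close> and \<open>v\<close>, so comparing both estimates shows that the second derivative is symmetric.\<close>

lemma second_difference_estimate:
  fixes f :: "'a::real_inner \<Rightarrow> real"
  assumes X: "convex X" "x \<in> X" "x + u \<in> X" "x + v \<in> X"
    and f: "\<And>y. y \<in> X \<Longrightarrow> (f has_derivative (\<lambda>h. G y \<bullet> h)) (at y within X)"
    and L: "linear L" and s: "0 < s" "s \<le> 1/2"
    and e: "\<And>a b. \<lbrakk>0 \<le> a; a \<le> s; 0 \<le> b; b \<le> s\<rbrakk> \<Longrightarrow>
      norm (G (x + a *\<^sub>R u + b *\<^sub>R v) - G x - L (a *\<^sub>R u + b *\<^sub>R v)) \<le> e * norm (a *\<^sub>R u + b *\<^sub>R v)"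
    and "e \<ge> 0"
  shows "\<bar>f (x + s *\<^sub>R u + s *\<^sub>R v) - f (x + s *\<^sub>R u) - f (x + s *\<^sub>R v) + f x - s\<^sup>2 * (L v \<bullet> u)\<bar>
    \<le> s\<^sup>2 * (e * ((2 * norm u + norm v) * norm u))"
proof -
  note in_X = convex_add_scaleR_add_scaleR_mem[OF X]
  \<comment> \<open>The second difference is \<open>\<psi> s - \<psi> 0\<close>, so the mean value
    theorem turns it into a first difference of \<open>G\<close> in direction
    \<open>v\<close>.\<close>
  define \<psi> where "\<psi> t = f ((x + s *\<^sub>R v) + t *\<^sub>R u) - f (x + t *\<^sub>R u)" for t
  let ?d = "\<lambda>t. G ((x + s *\<^sub>R v) + t *\<^sub>R u) - G (x + t *\<^sub>R u)"
  have in_X': "(x + s *\<^sub>R v) + t *\<^sub>R u \<in> X" "x + t *\<^sub>R u \<in> X" if "t \<in> {0..s}" for t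
    using in_X[of t s] in_X[of t 0] that s by (simp_all add: algebra_simps)
  have "(\<psi> has_derivative (\<lambda>h. h * (?d t \<bullet> u))) (at t within {0..s})" if t: "t \<in> {0..s}" for t
  proof -
    have "(\<psi> has_derivative (\<lambda>h. G ((x + s *\<^sub>R v) + t *\<^sub>R u) \<bullet> (h *\<^sub>R u) - G (x + t *\<^sub>R u) \<bullet> (h *\<^sub>R u)))
        (at t within {0..s})"
      unfolding \<psi>_def using in_X' t
      by (intro has_derivative_diff has_derivative_along_segment[where X = X] f) auto
    then show ?thesis by (simp add: inner_diff_left algebra_simps)
  qed
  then obtain t where t: "t \<in> {0<..<s}" and "\<psi> s - \<psi> 0 = (s - 0) * (?d t \<bullet> u)"
    using mvt_simple[of 0 s \<psi> "\<lambda>t h. h * (?d t \<bullet> u)"] s by auto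
  then have eq: "f (x + s *\<^sub>R u + s *\<^sub>R v) - f (x + s *\<^sub>R u) - f (x + s *\<^sub>R v) + f x = s * (?d t \<bullet> u)"
    by (simp add: \<psi>_def algebra_simps)
  \<comment> \<open>The error estimate is centred at \<open>x\<close>, so both values of
    \<open>G\<close> are compared with the linearisation there; the difference of the linear parts
    is \<open>s *\<^sub>R L v\<close>.\<close>
  let ?r = "\<lambda>b. G (x + t *\<^sub>R u + b *\<^sub>R v) - G x - L (t *\<^sub>R u + b *\<^sub>R v)"
  have r_eq: "?d t - s *\<^sub>R L v = ?r s - ?r 0"
    using L by (simp add: linear_add linear_cmul algebra_simps)
  have "norm (?r s) \<le> e * (s * norm u + s * norm v)"
  proof -
    have "norm (?r s) \<le> e * norm (t *\<^sub>R u + s *\<^sub>R v)" using e[of t s] t by simp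
    also have "norm (t *\<^sub>R u + s *\<^sub>R v) \<le> t * norm u + s * norm v"
      using norm_triangle_ineq[of "t *\<^sub>R u" "s *\<^sub>R v"] t s by simp
    also have "\<dots> \<le> s * norm u + s * norm v" using t by (simp add: mult_right_mono)
    finally show ?thesis using \<open>e \<ge> 0\<close> by (simp add: mult_left_mono)
  qed
  moreover have "norm (?r 0) \<le> e * (s * norm u)"
  proof -
    have "norm (?r 0) \<le> e * norm (t *\<^sub>R u)" using e[of t 0] t s by simp
    also have "norm (t *\<^sub>R u) \<le> s * norm u" using t by (simp add: mult_right_mono)
    finally show ?thesis using \<open>e \<ge> 0\<close> by (simp add: mult_left_mono)
  qed
  ultimately have "norm (?d t - s *\<^sub>R L v) \<le> s * (e * (2 * norm u + norm v))"
    unfolding r_eq using norm_triangle_ineq4[of "?r s" "?r 0"] by (simp add: algebra_simps)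
  then have "\<bar>(?d t - s *\<^sub>R L v) \<bullet> u\<bar> \<le> s * (e * (2 * norm u + norm v)) * norm u"
    by (rule order_trans[OF Cauchy_Schwarz_ineq2 mult_right_mono]) simp
  then have "s * \<bar>(?d t - s *\<^sub>R L v) \<bullet> u\<bar> \<le> s * (s * (e * (2 * norm u + norm v)) * norm u)"
    using s by (intro mult_left_mono) auto
  moreover have "s * (?d t \<bullet> u) - s\<^sup>2 * (L v \<bullet> u) = s * ((?d t - s *\<^sub>R L v) \<bullet> u)"
    by (simp add: power2_eq_square algebra_simps inner_diff_left)
  then have "\<bar>s * (?d t \<bullet> u) - s\<^sup>2 * (L v \<bullet> u)\<bar> = s * \<bar>(?d t - s *\<^sub>R L v) \<bullet> u\<bar>"
    using s by (simp add: abs_mult)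
  ultimately show ?thesis
    unfolding eq by (simp add: power2_eq_square mult_ac)
qed

text \<open>One second difference is approximated by both \<open>s ^ 2 * (L v \<bullet> u)\<close>
  and \<open>s ^ 2 * (L u \<bullet> v)\<close>. Dividing by \<open>s ^ 2\<close> shows that the two
  inner products differ by at most \<open>e * C\<close> for every \<open>e > 0\<close>.\<close>

lemma second_derivative_symmetric_aux:
  fixes f :: "'a::real_inner \<Rightarrow> real"
  assumes X: "convex X" "x \<in> X" "x + u \<in> X" "x + v \<in> X"
    and f: "\<And>y. y \<in> X \<Longrightarrow> (f has_derivative (\<lambda>h. G y \<bullet> h)) (at y within X)"
    and L: "(G has_derivative L) (at x within X)"
  shows "L u \<bullet> v = L v \<bullet> u"
proof -
  define C where "C = (2 * norm u + norm v) * norm u + (2 * norm v + norm u) * norm v"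
  have lin: "linear L" using L by (simp add: has_derivative_bounded_linear bounded_linear.linear)
  have C: "C \<ge> 0" by (simp add: C_def)
  have bound: "\<bar>L u \<bullet> v - L v \<bullet> u\<bar> \<le> e * C" if "e > 0" for e
  proof -
    obtain d where d: "d > 0" "\<And>y. y \<in> X \<Longrightarrow> norm (y - x) < d \<Longrightarrow>
        norm (G y - G x - L (y - x)) \<le> e * norm (y - x)"
      using L \<open>e > 0\<close> unfolding has_derivative_within_alt by blast
    \<comment> \<open>The first bound keeps the points in \<open>X\<close>, the second one keeps
      them within distance \<open>d\<close> of \<open>x\<close>; the summand 1 covers
      \<open>u = v = 0\<close>.\<close>
    define s where "s = min (1/2) (d / (2 * (norm u + norm v + 1)))"
    have s: "0 < s" using d by (auto simp: s_def add_nonneg_pos)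
    have "s \<le> 1/2" unfolding s_def by (rule min.cobounded1)
    note s = s this
    have "s \<le> d / (2 * (norm u + norm v + 1))" by (simp add: s_def)
    then have "s * (2 * (norm u + norm v + 1)) \<le> d"
      by (simp add: pos_le_divide_eq add_nonneg_pos)
    moreover have "0 < s * (norm u + norm v + 1)"
      using s by (simp add: add_nonneg_pos)
    ultimately have sd: "s * (norm u + norm v + 1) < d" by linarith
    have e: "norm (G (x + a *\<^sub>R u + b *\<^sub>R v) - G x - L (a *\<^sub>R u + b *\<^sub>R v)) \<le> e * norm (a *\<^sub>R u + b *\<^sub>R v)"
      if ab: "0 \<le> a" "a \<le> s" "0 \<le> b" "b \<le> s" for a b
    proof -
      have "x + a *\<^sub>R u + b *\<^sub>R v \<in> X"
        using ab s by (intro convex_add_scaleR_add_scaleR_mem[OF X]) auto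
      moreover have "norm (a *\<^sub>R u + b *\<^sub>R v) < d"
      proof -
        have "norm (a *\<^sub>R u + b *\<^sub>R v) \<le> a * norm u + b * norm v"
          using norm_triangle_ineq[of "a *\<^sub>R u" "b *\<^sub>R v"] ab by simp
        also have "\<dots> \<le> s * norm u + s * norm v"
          using ab by (intro add_mono mult_right_mono) auto
        also have "\<dots> < d" using sd s by (simp add: algebra_simps)
        finally show ?thesis .
      qed
      ultimately show ?thesis
        using d(2)[of "x + a *\<^sub>R u + b *\<^sub>R v"] by (simp add: algebra_simps)
    qed
    have e': "norm (G (x + a *\<^sub>R v + b *\<^sub>R u) - G x - L (a *\<^sub>R v + b *\<^sub>R u)) \<le> e * norm (a *\<^sub>R v + b *\<^sub>R u)"
      if ab: "0 \<le> a" "a \<le> s" "0 \<le> b" "b \<le> s" for a b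
      using e[of b a] that by (simp add: algebra_simps)
    let ?D = "f (x + s *\<^sub>R u + s *\<^sub>R v) - f (x + s *\<^sub>R u) - f (x + s *\<^sub>R v) + f x"
    have "\<bar>?D - s\<^sup>2 * (L v \<bullet> u)\<bar> \<le> s\<^sup>2 * (e * ((2 * norm u + norm v) * norm u))"
      using \<open>e > 0\<close> e by (intro second_difference_estimate[OF X f lin s]) auto
    moreover have "\<bar>?D - s\<^sup>2 * (L u \<bullet> v)\<bar> \<le> s\<^sup>2 * (e * ((2 * norm v + norm u) * norm v))"
      using second_difference_estimate[OF X(1,2,4,3) f lin s e'] \<open>e > 0\<close>
      by (simp add: algebra_simps)
    ultimately have "\<bar>s\<^sup>2 * (L u \<bullet> v) - s\<^sup>2 * (L v \<bullet> u)\<bar> \<le> s\<^sup>2 * (e * C)"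
      unfolding C_def by (simp only: distrib_left)
    then have "s\<^sup>2 * \<bar>L u \<bullet> v - L v \<bullet> u\<bar> \<le> s\<^sup>2 * (e * C)"
      by (simp flip: right_diff_distrib add: abs_mult)
    then show ?thesis using s by simp
  qed
  have "\<bar>L u \<bullet> v - L v \<bullet> u\<bar> \<le> 0"
  proof (rule field_le_epsilon)
    fix e :: real assume "e > 0"
    then have "\<bar>L u \<bullet> v - L v \<bullet> u\<bar> \<le> e / (C + 1) * C"
      using C by (intro bound) simp
    also have "\<dots> \<le> e" using C \<open>e > 0\<close> by (simp add: divide_simps)
    finally show "\<bar>L u \<bullet> v - L v \<bullet> u\<bar> \<le> 0 + e" by simp
  qed
  then show ?thesis by simp
qed

lemma direction_space_eq_span:
  assumes "x \<in> X"
  shows "direction_space X = span ((\<lambda>y. y - x) ` X)"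
proof
  have "y - z \<in> span ((\<lambda>y. y - x) ` X)" if "y \<in> X" "z \<in> X" for y z
  proof -
    have "(y - x) - (z - x) \<in> span ((\<lambda>y. y - x) ` X)"
      using that by (intro span_diff span_base) auto
    then show ?thesis by simp
  qed
  then show "direction_space X \<subseteq> span ((\<lambda>y. y - x) ` X)"
    unfolding direction_space_def by (intro span_minimal) auto
  show "span ((\<lambda>y. y - x) ` X) \<subseteq> direction_space X"
    unfolding direction_space_def using assms by (intro span_mono) auto
qed

text \<open>Both sides are bilinear and agree on the differences \<open>y - x\<close>, which span
  the direction space; the identity is extended in one argument at a time.\<close>

lemma second_derivative_symmetric:
  fixes f :: "'a::real_inner \<Rightarrow> real"
  assumes X: "convex X" "x \<in> X"
    and f: "\<And>y. y \<in> X \<Longrightarrow> (f has_derivative (\<lambda>h. G y \<bullet> h)) (at y within X)"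
    and L: "(G has_derivative L) (at x within X)"
    and u: "u \<in> direction_space X" and v: "v \<in> direction_space X"
  shows "L u \<bullet> v = L v \<bullet> u"
proof -
  have lin: "linear L" using L by (simp add: has_derivative_bounded_linear bounded_linear.linear)
  have lin1: "linear (\<lambda>u. L u \<bullet> v)" for v
    using lin by (intro linearI) (simp_all add: linear_add linear_cmul inner_add_left)
  have lin2: "linear (\<lambda>u. L v \<bullet> u)" for v
    by (intro linearI) (simp_all add: inner_add_right)
  let ?B = "(\<lambda>y. y - x) ` X"
  have 1: "L u \<bullet> v = L v \<bullet> u" if "u \<in> ?B" "v \<in> ?B" for u v
    using that by (intro second_derivative_symmetric_aux[OF X _ _ f L]) auto
  have 2: "L u \<bullet> v = L v \<bullet> u" if "u \<in> span ?B" "v \<in> ?B" for u v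
    using linear_eq_on_span[OF lin1 lin2 _ that(1), of v v] 1 that(2) by blast
  have "L u \<bullet> v = L v \<bullet> u" if "u \<in> span ?B" "v \<in> span ?B" for u v
    using linear_eq_on_span[OF lin2 lin1 _ that(2), of u u] 2 that(1) by blast
  then show ?thesis using u v by (simp add: direction_space_eq_span[OF X(2)])
qed

text \<open>The function \<open>z \<bullet> G y\<close> vanishes on \<open>X\<close>, so its
  derivative is 0 along the directions of \<open>X\<close>; on their orthogonal complement the
  Jacobian is 0 by normalisation.\<close>

lemma jacobian_on_orthogonal_range:
  fixes G :: "real^'n \<Rightarrow> real^'n"
  assumes X: "convex X" "x \<in> X" and G: "G differentiable (at x within X)"
    and range: "\<And>y. y \<in> X \<Longrightarrow> G y \<in> direction_space X"
    and z: "\<And>h. h \<in> direction_space X \<Longrightarrow> orthogonal z h"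
  shows "z \<bullet> (jacobian_on X G x *v h) = 0"
proof -
  let ?J = "jacobian_on X G x"
  have 0: "z \<bullet> (?J *v v) = 0" if "v \<in> direction_space X" for v
  proof -
    have "((\<lambda>y. z \<bullet> G y) has_derivative (\<lambda>h. z \<bullet> (?J *v h))) (at x within X)"
      using bounded_linear.has_derivative[OF bounded_linear_inner_right jacobian_on(1)[OF X G]] .
    moreover have "((\<lambda>y. z \<bullet> G y) has_derivative (\<lambda>h. 0)) (at x within X)"
      using has_derivative_const[of 0] by (rule has_derivative_transform[rotated 2])
        (use X z range in \<open>auto simp: orthogonal_def\<close>)
    ultimately show ?thesis
      using has_derivative_within_unique_direction_space[OF X _ _ that] by blast
  qed
  obtain v y where v: "v \<in> direction_space X"
    and y: "\<And>h. h \<in> direction_space X \<Longrightarrow> orthogonal y h" and h: "h = v + y"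
    unfolding direction_space_def by (rule orthogonal_subspace_decomp_exists) blast
  have "?J *v y = 0" using jacobian_on(2)[OF X G, of y] y by (simp add: orthogonal_commute)
  then show ?thesis using 0[OF v] by (simp add: h matrix_vector_right_distrib)
qed

text \<open>The normalisation of \<open>jacobian_on\<close> makes the Hessian symmetric on the whole space, not only on
  the directions of \<open>X\<close>.\<close>

lemma hessian_on_symmetric:
  fixes f :: "real^'n \<Rightarrow> real"
  assumes X: "convex X" "x \<in> X" and f: "f differentiable_on X"
    and G: "gradient_on X f differentiable (at x within X)"
  shows "(jacobian_on X (gradient_on X f) x *v a) \<bullet> b = a \<bullet> (jacobian_on X (gradient_on X f) x *v b)"
proof -
  let ?J = "jacobian_on X (gradient_on X f) x"
  have df: "f differentiable (at y within X)" if "y \<in> X" for y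
    using f that by (auto simp: differentiable_on_def)
  note orth = jacobian_on_orthogonal_range[OF X G gradient_on(1)[OF X(1) _ df]]
  have ker: "?J *v y = 0" if "\<And>h. h \<in> direction_space X \<Longrightarrow> orthogonal y h" for y
    using jacobian_on(2)[OF X G, of y] that by (simp add: orthogonal_commute)
  obtain v y where v: "v \<in> direction_space X"
    and y: "\<And>h. h \<in> direction_space X \<Longrightarrow> orthogonal y h" and a: "a = v + y"
    unfolding direction_space_def by (rule orthogonal_subspace_decomp_exists) blast
  obtain v' y' where v': "v' \<in> direction_space X"
    and y': "\<And>h. h \<in> direction_space X \<Longrightarrow> orthogonal y' h" and b: "b = v' + y'"
    unfolding direction_space_def by (rule orthogonal_subspace_decomp_exists) blast
  have "(?J *v v) \<bullet> v' = (?J *v v') \<bullet> v"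
    using second_derivative_symmetric[OF X gradient_on(2)[OF X(1) _ df] jacobian_on(1)[OF X G] v v']
    by simp
  moreover have "y \<bullet> (?J *v h) = 0" "y' \<bullet> (?J *v h) = 0" for h
    using orth[OF _ _ y] orth[OF _ _ y'] by auto
  ultimately show ?thesis
    using ker[OF y] ker[OF y'] unfolding a b
    by (simp add: matrix_vector_right_distrib inner_add_left inner_add_right inner_commute)
qed

section \<open>Positive semidefiniteness of the Hessian\<close>

lemma rel_interior_direction:
  fixes X :: "'a::euclidean_space set"
  assumes x: "x \<in> rel_interior X" and v: "v \<in> direction_space X"
  obtains s where "s > 0" "x + s *\<^sub>R v \<in> X"
proof -
  obtain e where e: "e > 0" "ball x e \<inter> affine hull X \<subseteq> X" and xX: "x \<in> X"
    using x by (auto simp: mem_rel_interior_ball)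
  define s where "s = e / (2 * (norm v + 1))"
  have s: "s > 0" using e by (simp add: s_def add_nonneg_pos)
  have "s * norm v < e"
    using e by (simp add: s_def divide_simps add_nonneg_pos)
  then have "x + s *\<^sub>R v \<in> ball x e" using s by (simp add: dist_norm)
  moreover have "x + s *\<^sub>R v \<in> affine hull X"
  proof -
    \<comment> \<open>Leaving out \<open>x\<close> removes at most the zero vector from the
      generators and gives the form of \<open>affine_hull_span2\<close>.\<close>
    have "span ((\<lambda>y. y - x) ` X) = span ((\<lambda>y. - x + y) ` X)"
      by (simp add: add.commute)
    also have "\<dots> \<subseteq> span ((\<lambda>y. - x + y) ` (X - {x}))"
    proof (intro span_minimal subsetI subspace_span)
      fix h assume "h \<in> (\<lambda>y. - x + y) ` X"
      then show "h \<in> span ((\<lambda>y. - x + y) ` (X - {x}))"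
        by (cases "h = 0") (auto intro: span_base span_zero)
    qed
    finally have "s *\<^sub>R v \<in> span ((\<lambda>y. - x + y) ` (X - {x}))"
      using v unfolding direction_space_eq_span[OF xX] by (blast intro: span_scale)
    then show ?thesis unfolding affine_hull_span2[OF xX] by blast
  qed
  ultimately show ?thesis using that s e by blast
qed

text \<open>Monotonicity makes the difference quotients of \<open>G y \<bullet> v\<close> along the
  segment nonnegative, and \<open>L v \<bullet> v\<close> is their limit.\<close>

lemma monotone_derivative_nonneg:
  fixes G :: "'a::real_inner \<Rightarrow> 'a"
  assumes X: "convex X" "x \<in> X" "x + v \<in> X"
    and G: "(G has_derivative L) (at x within X)"
    and mono: "\<And>y. y \<in> X \<Longrightarrow> 0 \<le> (G y - G x) \<bullet> (y - x)"
  shows "0 \<le> L v \<bullet> v"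
proof -
  let ?c = "\<lambda>t::real. x + t *\<^sub>R v"
  have cX: "?c t \<in> X" if "t \<in> {0..1}" for t
  proof -
    have "?c t = (1 - t) *\<^sub>R x + t *\<^sub>R (x + v)" by (simp add: algebra_simps)
    then show ?thesis using convexD[OF X, of "1 - t" t] that by simp
  qed
  have "((\<lambda>y. G y \<bullet> v) has_derivative (\<lambda>h. L h \<bullet> v)) (at (?c 0) within X)"
    using bounded_linear.has_derivative[OF bounded_linear_inner_left G] by simp
  from has_derivative_along_segment[OF this cX]
  have "((\<lambda>t. G (?c t) \<bullet> v) has_derivative (\<lambda>h. L (h *\<^sub>R v) \<bullet> v)) (at 0 within {0..1})" .
  moreover have "L (h *\<^sub>R v) \<bullet> v = (L v \<bullet> v) * h" for h
    using has_derivative_bounded_linear[OF G] by (simp add: bounded_linear.linear linear_cmul)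
  ultimately have "((\<lambda>t. G (?c t) \<bullet> v) has_field_derivative L v \<bullet> v) (at 0 within {0..1})"
    by (simp add: has_field_derivative_def mult_commute_abs)
  then have "((\<lambda>t. (G (?c t) \<bullet> v - G x \<bullet> v) / t) \<longlongrightarrow> L v \<bullet> v) (at 0 within {0..1})"
    by (simp add: has_field_derivative_iff)
  moreover have "\<forall>\<^sub>F t in at 0 within {0..1}. 0 \<le> (G (?c t) \<bullet> v - G x \<bullet> v) / t"
  proof (unfold eventually_at_filter, intro always_eventually allI impI)
    fix t :: real assume t: "t \<noteq> 0" "t \<in> {0..1}"
    then have "0 \<le> t * ((G (?c t) - G x) \<bullet> v)" using mono[OF cX[OF t(2)]] by simp
    then show "0 \<le> (G (?c t) \<bullet> v - G x \<bullet> v) / t"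
      using t by (simp add: zero_le_mult_iff inner_diff_left)
  qed
  moreover have "at (0::real) within {0..1} \<noteq> bot" by (simp add: at_within_Icc_at_right)
  ultimately show ?thesis using tendsto_lowerbound by blast
qed

text \<open>At a relative interior point every direction of \<open>X\<close> can be followed inside
  \<open>X\<close>, so monotonicity of the gradient applies. At a boundary point some directions
  leave \<open>X\<close> at once; there the inequality is a limit from relative interior points, by
  continuity of the Hessian. The component of \<open>v\<close> orthogonal to the directions
  contributes nothing.\<close>

lemma hessian_on_nonneg:
  fixes f :: "real^'n \<Rightarrow> real"
  assumes X: "convex X" "x \<in> X" and f: "f differentiable_on X" "convex_on X f"
    and G: "gradient_on X f differentiable_on X"
    and cont: "continuous_on X (jacobian_on X (gradient_on X f))"
  shows "0 \<le> v \<bullet> (jacobian_on X (gradient_on X f) x *v v)"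
proof -
  let ?G = "gradient_on X f"
  let ?J = "jacobian_on X ?G"
  have df: "f differentiable (at y within X)" if "y \<in> X" for y
    using f that by (auto simp: differentiable_on_def)
  have dG: "?G differentiable (at y within X)" if "y \<in> X" for y
    using G that by (auto simp: differentiable_on_def)
  have mono: "0 \<le> (?G y - ?G z) \<bullet> (y - z)" if "y \<in> X" "z \<in> X" for y z
    using convex_on_gradient_inequality[OF f(2) that gradient_on(2)[OF X(1) that(1) df[OF that(1)]]]
      convex_on_gradient_inequality[OF f(2) that(2,1) gradient_on(2)[OF X(1) that(2) df[OF that(2)]]]
    by (simp add: inner_diff_left inner_diff_right)
  have ri: "0 \<le> (?J z *v u) \<bullet> u" if z: "z \<in> rel_interior X" and u: "u \<in> direction_space X" for z u
  proof -
    obtain s where s: "s > 0" "z + s *\<^sub>R u \<in> X" by (rule rel_interior_direction[OF z u])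
    have zX: "z \<in> X" using z rel_interior_subset by blast
    have "0 \<le> (?J z *v (s *\<^sub>R u)) \<bullet> (s *\<^sub>R u)"
      using mono zX by (intro monotone_derivative_nonneg[OF X(1) zX s(2) jacobian_on(1)[OF X(1) zX dG[OF zX]]])
    then show ?thesis using s by (simp add: matrix_vector_mult_scaleR zero_le_mult_iff)
  qed
  have nonneg: "0 \<le> (?J x *v u) \<bullet> u" if u: "u \<in> direction_space X" for u
  proof -
    obtain c where c: "c \<in> rel_interior X" using X rel_interior_eq_empty by blast
    let ?z = "\<lambda>n. x - inverse (real (Suc n)) *\<^sub>R (x - c)"
    have z: "?z n \<in> rel_interior X" for n
      using X c by (intro rel_interior_convex_shrink) (auto simp: divide_simps)
    have "?z \<longlonglongrightarrow> x - 0 *\<^sub>R (x - c)"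
      by (intro tendsto_intros LIMSEQ_inverse_real_of_nat)
    then have "(\<lambda>n. ?J (?z n)) \<longlonglongrightarrow> ?J x"
      using subsetD[OF rel_interior_subset z] X(2)
      by (intro continuous_on_tendsto_compose[OF cont] always_eventually allI) simp_all
    then have "(\<lambda>n. (?J (?z n) *v u) \<bullet> u) \<longlonglongrightarrow> (?J x *v u) \<bullet> u"
      unfolding matrix_vector_mult_def by (intro tendsto_intros)
    then show ?thesis using ri[OF z u] by (intro tendsto_lowerbound) auto
  qed
  obtain a b where a: "a \<in> direction_space X"
    and b: "\<And>h. h \<in> direction_space X \<Longrightarrow> orthogonal b h" and v: "v = a + b"
    unfolding direction_space_def by (rule orthogonal_subspace_decomp_exists) blast
  have "?J x *v b = 0"
    using jacobian_on(2)[OF X dG[OF X(2)], of b] b by (simp add: orthogonal_commute)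
  moreover have "b \<bullet> (?J x *v h) = 0" for h
    using jacobian_on_orthogonal_range[OF X dG[OF X(2)] gradient_on(1)[OF X(1) _ df] b] by auto
  ultimately show ?thesis
    using nonneg[OF a] by (simp add: v matrix_vector_right_distrib inner_add_left inner_commute)
qed

section \<open>Powers of a positive semidefinite matrix\<close>

primrec matpow :: "real^'n^'n \<Rightarrow> nat \<Rightarrow> real^'n^'n" where
  "matpow A 0 = mat 1"
| "matpow A (Suc k) = A ** matpow A k"

lemma matpow_add: "matpow A (j + k) = matpow A j ** matpow A k"
  by (induction j) (simp_all add: matrix_mul_assoc)

text \<open>Induction in steps of two: symmetry moves one factor \<open>A\<close> to the left
  argument, which leaves the form of the power \<open>k\<close> at the vector
  \<open>A *v a\<close>.\<close>

lemma matpow_nonneg: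
  assumes sym: "\<And>a b. (A *v a) \<bullet> b = a \<bullet> (A *v b)" and nonneg: "\<And>a. 0 \<le> a \<bullet> (A *v a)"
  shows "0 \<le> a \<bullet> (matpow A k *v a)"
proof (induction k arbitrary: a rule: induct_nat_012)
  case (ge2 k)
  have comm: "matpow A k ** A = A ** matpow A k"
    using matpow_add[of A k 1] matpow_add[of A 1 k] by (simp add: add.commute)
  have "matpow A (Suc (Suc k)) *v a = A *v ((A ** matpow A k) *v a)"
    by (simp add: matrix_vector_mul_assoc)
  also have "\<dots> = A *v (matpow A k *v (A *v a))"
    unfolding comm[symmetric] by (simp add: matrix_vector_mul_assoc)
  finally have "a \<bullet> (matpow A (Suc (Suc k)) *v a) = (A *v a) \<bullet> (matpow A k *v (A *v a))"
    by (simp add: sym)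
  then show ?case using ge2.IH(1)[of "A *v a"] by simp
qed (use nonneg in auto)

section \<open>Lyapunov's direct method\<close>

text \<open>Mean value theorem for \<open>V\<close> along the trajectory. The bound is required
  strictly between \<open>s\<close> and \<open>t\<close> only, so that \<open>t\<close> may be a
  first exit time from the region where it holds.\<close>

lemma lyapunov_nonincreasing:
  fixes F :: "'a::real_normed_vector \<Rightarrow> 'a" and V :: "'a \<Rightarrow> real"
  assumes u: "ode_solution_on J X F u" and J: "{s..t} \<subseteq> J" "s \<le> t"
    and V: "\<And>x. x \<in> X \<Longrightarrow> (V has_derivative V' x) (at x within X)"
    and le: "\<And>\<tau>. s < \<tau> \<Longrightarrow> \<tau> < t \<Longrightarrow> V' (u \<tau>) (F (u \<tau>)) \<le> - b"
  shows "V (u t) \<le> V (u s) - b * (t - s)"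
proof (cases "s = t")
  case False
  have der: "((\<lambda>\<tau>. V (u \<tau>)) has_derivative (\<lambda>h. h * V' (u \<tau>) (F (u \<tau>)))) (at \<tau> within {s..t})"
    if "\<tau> \<in> {s..t}" for \<tau>
  proof -
    have \<tau>: "\<tau> \<in> J" "u \<tau> \<in> X" "(u has_vector_derivative F (u \<tau>)) (at \<tau> within {s..t})"
      using u that J(1) has_vector_derivative_within_subset[OF _ J(1), of u "F (u \<tau>)" \<tau>]
      unfolding ode_solution_on_def by auto
    have "u ` {s..t} \<subseteq> X" using u J(1) unfolding ode_solution_on_def by auto
    then have "(V has_derivative V' (u \<tau>)) (at (u \<tau>) within u ` {s..t})"
      using has_derivative_subset[OF V[OF \<tau>(2)]] by blast
    from has_derivative_in_compose[OF \<tau>(3)[unfolded has_vector_derivative_def] this]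
    show ?thesis
      using has_derivative_bounded_linear[OF V[OF \<tau>(2)]]
      by (simp add: bounded_linear.linear linear_cmul)
  qed
  then obtain \<tau> where \<tau>: "\<tau> \<in> {s<..<t}" "V (u t) - V (u s) = (t - s) * V' (u \<tau>) (F (u \<tau>))"
    using mvt_simple[of s t "\<lambda>\<tau>. V (u \<tau>)" "\<lambda>\<tau> h. h * V' (u \<tau>) (F (u \<tau>))"] J(2) False by auto
  then have "(t - s) * V' (u \<tau>) (F (u \<tau>)) \<le> (t - s) * - b"
    using le J(2) by (intro mult_left_mono) auto
  then show ?thesis using \<tau>(2) by (simp add: mult.commute)
qed simp

lemma ode_solution_on_subset:
  assumes "ode_solution_on J X F u" "I \<subseteq> J"
  shows "ode_solution_on I X F u"
  using assms has_vector_derivative_within_subset unfolding ode_solution_on_def by blast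

lemma ode_solution_on_continuous:
  assumes "ode_solution_on J X F u"
  shows "continuous_on J u"
  using assms unfolding ode_solution_on_def
  by (intro continuous_on_vector_derivative) auto

text \<open>Outside the ball \<open>V\<close> attains a minimum by compactness, and this minimum can
  serve as \<open>m\<close>.\<close>

lemma compact_strict_min_gap:
  fixes V :: "'a::metric_space \<Rightarrow> real"
  assumes X: "compact X" and V: "continuous_on X V" "\<And>x. x \<in> X \<Longrightarrow> x \<noteq> a \<Longrightarrow> V a < V x"
    and "e > 0"
  obtains m where "V a < m" "\<And>x. x \<in> X \<Longrightarrow> V x < m \<Longrightarrow> dist x a < e"
proof (cases "X - ball a e = {}")
  case True
  then show ?thesis by (intro that[of "V a + 1"]) (auto simp: dist_commute)
next
  case False
  have "compact (X - ball a e)" using X by (simp add: compact_diff)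
  then obtain x where x: "x \<in> X - ball a e" "\<And>y. y \<in> X - ball a e \<Longrightarrow> V x \<le> V y"
    using continuous_attains_inf[OF _ False, of V] continuous_on_subset[OF V(1)] by blast
  then have "V a < V x" using V(2)[of x] \<open>e > 0\<close> by (cases "x = a") auto
  moreover have "dist y a < e" if "y \<in> X" "V y < V x" for y
    using x(2)[of y] that by (force simp: dist_commute not_less)
  ultimately show ?thesis using that by blast
qed

text \<open>Start where \<open>V\<close> is below the gap value \<open>m\<close> of the ball of
  radius \<open>e'\<close>. Up to the first exit from this ball \<open>V\<close> does not increase,
  as \<open>e' \<le> \<rho>\<close>; at the exit it is still below \<open>m\<close>, which places
  the point inside the ball.\<close>

lemma lyapunov_stable_onI:
  fixes F :: "'a::real_normed_vector \<Rightarrow> 'a" and V :: "'a \<Rightarrow> real"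
  assumes X: "compact X" "a \<in> X"
    and V: "\<And>x. x \<in> X \<Longrightarrow> (V has_derivative V' x) (at x within X)"
    and min: "\<And>x. x \<in> X \<Longrightarrow> x \<noteq> a \<Longrightarrow> V a < V x"
    and \<rho>: "\<rho> > 0" and le: "\<And>x. x \<in> X \<Longrightarrow> dist x a < \<rho> \<Longrightarrow> V' x (F x) \<le> 0"
  shows "lyapunov_stable_on X F a"
  unfolding lyapunov_stable_on_def
proof (intro allI impI)
  fix e :: real assume "e > 0"
  define e' where "e' = min e \<rho>"
  have e': "e' > 0" "e' \<le> e" "e' \<le> \<rho>" using \<open>e > 0\<close> \<rho> by (auto simp: e'_def)
  have contV: "continuous_on X V"
    using V has_derivative_continuous continuous_on_eq_continuous_within by blast
  obtain m where m: "V a < m" "\<And>x. x \<in> X \<Longrightarrow> V x < m \<Longrightarrow> dist x a < e'"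
    using compact_strict_min_gap[OF X(1) contV min e'(1)] by blast
  obtain d where d: "d > 0" "\<And>x. x \<in> X \<Longrightarrow> dist x a < d \<Longrightarrow> dist (V x) (V a) < m - V a"
    using contV X(2) m(1) unfolding continuous_on_iff by (metis diff_gt_0_iff_gt)
  have "dist (u t) a < e'"
    if u: "ode_solution_on {0..T} X F u" and u0: "dist (u 0) a < min d e'" and t: "t \<in> {0..T}" for u T t
  proof (rule ccontr)
    assume far: "\<not> dist (u t) a < e'"
    have cu: "continuous_on {0..T} (\<lambda>s. dist (u s) a)"
      by (intro continuous_intros ode_solution_on_continuous[OF u])
    have uX: "u s \<in> X" if "s \<in> {0..T}" for s using u that by (auto simp: ode_solution_on_def)
    \<comment> \<open>The times spent outside the open ball; the least of them is the exit
      time.\<close>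
    define S where "S = {0..T} \<inter> (\<lambda>s. dist (u s) a) -` {e'..}"
    have "closed S" unfolding S_def
      by (intro continuous_closed_preimage cu) auto
    then have "compact S" unfolding S_def
      by (metis compact_Icc compact_Int_closed inf.idem inf_assoc)
    moreover have "t \<in> S" using far t by (auto simp: S_def)
    ultimately obtain t1 where t1: "t1 \<in> S" "\<And>s. s \<in> S \<Longrightarrow> t1 \<le> s"
      using compact_attains_inf[of S] by blast
    have "dist (u s) a < \<rho>" "u s \<in> X" if "0 < s" "s < t1" for s
    proof -
      have "s \<notin> S" "s \<in> {0..T}" using t1(2)[of s] that t1(1) by (auto simp: S_def)
      then show "dist (u s) a < \<rho>" "u s \<in> X" using e' uX by (auto simp: S_def)
    qed
    then have "V (u t1) \<le> V (u 0) - 0 * (t1 - 0)"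
      using t1(1) le by (intro lyapunov_nonincreasing[OF u _ _ V]) (auto simp: S_def)
    also have "\<dots> < m" using d(2)[of "u 0"] u0 uX[of 0] t by (auto simp: dist_real_def)
    finally have "dist (u t1) a < e'" using m(2) uX t1(1) by (auto simp: S_def)
    then show False using t1(1) by (auto simp: S_def)
  qed
  then show "\<exists>d>0. \<forall>u T. ode_solution_on {0..T} X F u \<longrightarrow> dist (u 0) a < d \<longrightarrow>
      (\<forall>t\<in>{0..T}. dist (u t) a < e)"
    using d(1) e' by (intro exI[of _ "min d e'"]) force
qed

text \<open>Stability keeps trajectories where the decay estimate holds. If \<open>V\<close> stayed
  at least \<open>m > V a\<close>, the trajectory would remain in a compact set on which
  \<open>W\<close> has a positive minimum, and \<open>V\<close> would decrease without bound. So
  \<open>V\<close> falls below \<open>m\<close>, stays there, and confines the trajectory to the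
  ball belonging to \<open>m\<close>.\<close>

lemma asymptotically_stable_onI:
  fixes F :: "'a::real_normed_vector \<Rightarrow> 'a" and V W :: "'a \<Rightarrow> real"
  assumes X: "compact X" "a \<in> X"
    and V: "\<And>x. x \<in> X \<Longrightarrow> (V has_derivative V' x) (at x within X)"
    and min: "\<And>x. x \<in> X \<Longrightarrow> x \<noteq> a \<Longrightarrow> V a < V x"
    and W: "continuous_on X W" "W a \<ge> 0" "\<And>x. x \<in> X \<Longrightarrow> x \<noteq> a \<Longrightarrow> W x > 0"
    and \<rho>: "\<rho> > 0" and le: "\<And>x. x \<in> X \<Longrightarrow> dist x a < \<rho> \<Longrightarrow> V' x (F x) \<le> - W x"
  shows "asymptotically_stable_on X F a"
proof -
  have W0: "0 \<le> W x" if "x \<in> X" for x using W that by (cases "x = a") (auto simp: less_imp_le)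
  have le0: "V' x (F x) \<le> 0" if "x \<in> X" "dist x a < \<rho>" for x using le W0 that by fastforce
  have stable: "lyapunov_stable_on X F a"
    by (rule lyapunov_stable_onI[OF X V min \<rho> le0])
  have contV: "continuous_on X V"
    using V has_derivative_continuous continuous_on_eq_continuous_within by blast
  obtain d where d: "d > 0" "\<And>u T t. ode_solution_on {0..T} X F u \<Longrightarrow> dist (u 0) a < d \<Longrightarrow>
      t \<in> {0..T} \<Longrightarrow> dist (u t) a < \<rho>"
    using stable \<rho> unfolding lyapunov_stable_on_def by meson
  have "(u \<longlongrightarrow> a) at_top" if u: "ode_solution_on {0..} X F u" and u0: "dist (u 0) a < d" for u
  proof (rule tendstoI)
    fix e :: real assume "e > 0"
    have uX: "u t \<in> X" if "t \<ge> 0" for t using u that by (auto simp: ode_solution_on_def)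
    have near: "dist (u t) a < \<rho>" if "t \<ge> 0" for t
      using d(2)[of t u t] ode_solution_on_subset[OF u, of "{0..t}"] u0 that by auto
    obtain m where m: "V a < m" "\<And>x. x \<in> X \<Longrightarrow> V x < m \<Longrightarrow> dist x a < e"
      using compact_strict_min_gap[OF X(1) contV min \<open>e > 0\<close>] by blast
    have "\<exists>t0\<ge>0. V (u t0) < m"
    proof (rule ccontr)
      assume "\<not> ?thesis"
      then have ge: "m \<le> V (u t)" if "t \<ge> 0" for t using that by force
      define S where "S = X \<inter> V -` {m..}"
      have "closed S" unfolding S_def
        using contV X(1) by (intro continuous_closed_preimage) (auto simp: compact_imp_closed)
      then have "compact S" unfolding S_def by (metis X(1) compact_Int_closed inf.idem inf_assoc)
      moreover have "u 0 \<in> S" using ge[of 0] uX by (auto simp: S_def)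
      ultimately obtain x where x: "x \<in> S" "\<And>y. y \<in> S \<Longrightarrow> W x \<le> W y"
        using continuous_attains_inf[of S W] continuous_on_subset[OF W(1), of S] by (auto simp: S_def)
      have b: "W x > 0" using W(3)[of x] x(1) m(1) by (cases "x = a") (auto simp: S_def)
      have decay: "V (u t) \<le> V (u 0) - W x * (t - 0)" if "t \<ge> 0" for t
      proof (rule lyapunov_nonincreasing[OF u _ that V])
        fix \<tau> :: real assume "0 < \<tau>"
        then have "u \<tau> \<in> S" "V' (u \<tau>) (F (u \<tau>)) \<le> - W (u \<tau>)"
          using ge[of \<tau>] uX[of \<tau>] near[of \<tau>] le by (auto simp: S_def)
        then show "V' (u \<tau>) (F (u \<tau>)) \<le> - W x" using x(2) by fastforce
      qed auto
      \<comment> \<open>At this time the linear upper bound for \<open>V\<close> has come down to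
        \<open>m - 1\<close>.\<close>
      define t where "t = (V (u 0) - m + 1) / W x"
      have "t \<ge> 0" using ge[of 0] b by (simp add: t_def)
      moreover have "W x * t = V (u 0) - m + 1" using b by (simp add: t_def)
      ultimately show False using decay[of t] ge[of t] by simp
    qed
    then obtain t0 where t0: "t0 \<ge> 0" "V (u t0) < m" by blast
    have "dist (u t) a < e" if "t \<ge> t0" for t
    proof -
      have "V (u t) \<le> V (u t0) - 0 * (t - t0)"
        using t0(1) uX near le0 by (intro lyapunov_nonincreasing[OF u _ that V]) auto
      then show ?thesis using m(2)[of "u t"] uX[of t] t0 that by simp
    qed
    then show "\<forall>\<^sub>F t in at_top. dist (u t) a < e"
      unfolding eventually_at_top_linorder by blast
  qed
  then show ?thesis
    using stable d(1) unfolding asymptotically_stable_on_def attractive_on_def by blast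
qed

section \<open>Expansion on the slow manifold\<close>

lemma jacobian_on_add_scaleR:
  fixes u v :: "real^'n \<Rightarrow> real^'n"
  assumes X: "convex X" "x \<in> X"
    and u: "u differentiable (at x within X)" and v: "v differentiable (at x within X)"
  shows "jacobian_on X (\<lambda>y. u y + c *\<^sub>R v y) x = jacobian_on X u x + c *\<^sub>R jacobian_on X v x"
proof (rule jacobian_on_eqI[OF X])
  have *: "(jacobian_on X u x + c *\<^sub>R jacobian_on X v x) *v h =
      jacobian_on X u x *v h + c *\<^sub>R (jacobian_on X v x *v h)" for h
    by (simp add: matrix_vector_mult_add_rdistrib scaleR_matrix_vector_assoc)
  show "((\<lambda>y. u y + c *\<^sub>R v y) has_derivative
      (\<lambda>h. (jacobian_on X u x + c *\<^sub>R jacobian_on X v x) *v h)) (at x within X)"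
    unfolding *
    by (intro has_derivative_add has_derivative_scaleR_right jacobian_on(1)[OF X] u v)
  show "(jacobian_on X u x + c *\<^sub>R jacobian_on X v x) *v h = 0"
    if "\<And>v. v \<in> direction_space X \<Longrightarrow> orthogonal v h" for h
    unfolding * using jacobian_on(2)[OF X u that] jacobian_on(2)[OF X v that] by simp
qed

text \<open>Serves to drop the terms of the recursion with even index, where the factor
  \<open>g (2 * k - l)\<close> vanishes.\<close>

lemma sum_odd_indices:
  fixes F :: "nat \<Rightarrow> 'a::comm_monoid_add"
  assumes "\<And>j. 1 \<le> j \<Longrightarrow> j < k \<Longrightarrow> F (2 * j) = 0"
  shows "(\<Sum>l = 1..2 * k - 1. F l) = (\<Sum>j<k. F (2 * j + 1))"
  using assms
proof (induction k)
  case (Suc k)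
  show ?case
  proof (cases "k = 0")
    case False
    then obtain m where k: "k = Suc m" by (cases k) auto
    have "F (Suc (Suc (2 * m))) = 0" using Suc.prems[of k] by (simp add: k)
    then show ?thesis using Suc by (simp add: k)
  qed simp
qed simp

context bounded_weight
begin

lemma bigo_vec_bound:
  assumes "bigo_vec m d u"
  obtains K where "\<And>x. x \<in> X \<Longrightarrow> norm (u x) \<le> K * w x ^ d"
proof -
  have "\<exists>K. \<forall>x\<in>X. \<bar>u x $ i\<bar> \<le> K * w x ^ d" for i
    using assms bigo_Dk_bound unfolding bigo_vec_def by metis
  then obtain K where K: "\<And>i x. x \<in> X \<Longrightarrow> \<bar>u x $ i\<bar> \<le> K i * w x ^ d" by metis
  have "norm (u x) \<le> (\<Sum>i\<in>UNIV. K i) * w x ^ d" if "x \<in> X" for x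
    unfolding sum_distrib_right using K[OF that]
    by (intro order_trans[OF norm_le_l1_cart] sum_mono)
  then show ?thesis by (rule that)
qed

lemma bigo_mat_matpow:
  assumes "bigo_mat m 0 A"
  shows "bigo_mat m 0 (\<lambda>x. matpow (A x) k)"
proof (induction k)
  case 0
  then show ?case by (simp add: bigo_mat_const)
next
  case (Suc k)
  then show ?case using bigo_mat_mult[OF assms] by fastforce
qed

text \<open>Modulo terms quadratic in \<open>G\<close>, the recursion for \<open>g\<close> is the Catalan recursion for the
  coefficients of \<open>(jacobian_on X G)\<^sup>k G\<close>.\<close>

lemma slow_manifold_expansion:
  fixes g :: "nat \<Rightarrow> real^'n \<Rightarrow> real^'n"
  assumes G: "bigo_vec r 1 G" and "\<eta> > 0"
    and g1: "\<And>x. x \<in> X \<Longrightarrow> g 1 x = - \<eta> *\<^sub>R G x"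
    and even: "\<And>k x. k \<ge> 1 \<Longrightarrow> x \<in> X \<Longrightarrow> g (2 * k) x = 0"
    and odd: "\<And>k x. k \<ge> 1 \<Longrightarrow> x \<in> X \<Longrightarrow>
      g (2 * k + 1) x = - (\<Sum>l = 1..2 * k - 1. jacobian_on X (g l) x *v g (2 * k - l) x)"
    and "k \<le> r"
  shows "\<exists>c>0. bigo_vec (r - k) 2 (\<lambda>x. g (2 * k + 1) x + c *\<^sub>R (matpow (jacobian_on X G x) k *v G x))"
  using \<open>k \<le> r\<close>
proof (induction k rule: less_induct)
  case (less k)
  let ?A = "\<lambda>k x. matpow (jacobian_on X G x) k"
  show ?case
  proof (cases "k = 0")
    case True
    \<comment> \<open>The coefficient is \<open>\<eta>\<close> and the remainder is exactly
      0.\<close>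
    have "bigo_vec (r - k) 2 (\<lambda>x. g (2 * k + 1) x + \<eta> *\<^sub>R (?A k x *v G x))"
      using True g1 by (subst bigo_vec_cong[where v = "\<lambda>_. 0"]) (simp_all add: bigo_vec_def bigo_Dk_zero)
    then show ?thesis using \<open>\<eta> > 0\<close> by blast
  next
    case False
    have "\<forall>j. \<exists>c. j < k \<longrightarrow>
        c > 0 \<and> bigo_vec (r - j) 2 (\<lambda>x. g (2 * j + 1) x + c *\<^sub>R (?A j x *v G x))"
    proof
      fix j
      show "\<exists>c. j < k \<longrightarrow>
          c > 0 \<and> bigo_vec (r - j) 2 (\<lambda>x. g (2 * j + 1) x + c *\<^sub>R (?A j x *v G x))"
        using less.IH[of j] less.prems by (cases "j < k") auto
    qed
    from choice[OF this] obtain c where c: "\<And>j. j < k \<Longrightarrow> c j > 0"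
      and R: "\<And>j. j < k \<Longrightarrow> bigo_vec (r - j) 2 (\<lambda>x. g (2 * j + 1) x + c j *\<^sub>R (?A j x *v G x))"
      by blast
    let ?R = "\<lambda>j x. g (2 * j + 1) x + c j *\<^sub>R (?A j x *v G x)"
    have H: "bigo_mat (r - 1) 0 (jacobian_on X G)"
      using bigo_mat_jacobian[of "r - 1" 1 G] G False less.prems by simp
    \<comment> \<open>The power 0 is constant and has derivatives of any order; the others inherit
      the \<open>r - 1\<close> derivatives of the Hessian.\<close>
    have A: "bigo_mat m 0 (?A j)" if "j = 0 \<or> m \<le> r - 1" for m j
    proof (cases "j = 0")
      case False
      then show ?thesis using that by (intro bigo_mat_matpow bigo_mat_mono[OF H]) auto
    qed (simp add: bigo_mat_const)
    \<comment> \<open>Modulo order 1 the Jacobian of \<open>g (2 * j + 1)\<close> is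
      \<open>- c j\<close> times the power \<open>j + 1\<close> of the Hessian. Differentiating the
      remainder lowers its order from 2 to 1, and so does no harm.\<close>
    have Q: "bigo_mat (r - k) 1 (\<lambda>x. jacobian_on X (g (2 * j + 1)) x + c j *\<^sub>R ?A (Suc j) x)"
      if j: "j < k" for j
    proof -
      \<comment> \<open>The number of derivatives left after \<open>g (2 * j + 1)\<close> has been
        differentiated once.\<close>
      define m where "m = r - Suc j"
      have m: "Suc m = r - j" "r - k \<le> m" using j less.prems by (auto simp: m_def)
      have Rj: "bigo_vec (Suc m) 2 (?R j)" using R[OF j] m by simp
      have Aj: "bigo_mat (Suc m) 0 (?A j)" using m by (intro A) auto
      have Gm: "bigo_vec (Suc m) 1 G" using G by (rule bigo_vec_mono) (simp_all add: m)
      have AG: "bigo_vec (Suc m) 1 (\<lambda>x. ?A j x *v G x)" using bigo_mat_vec_mult[OF Aj Gm] by simp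
      have "bigo_mat m 1 (\<lambda>x. jacobian_on X (?R j) x +
          (- c j) *\<^sub>R (jacobian_on X (\<lambda>x. ?A j x *v G x) x - ?A j x ** jacobian_on X G x))"
        using bigo_mat_jacobian[OF Rj] bigo_mat_jacobian_mult[OF Aj Gm]
        by (intro bigo_mat_add bigo_mat_scaleR) auto
      then have "bigo_mat m 1 (\<lambda>x. jacobian_on X (g (2 * j + 1)) x + c j *\<^sub>R ?A (Suc j) x)"
      proof (rule bigo_mat_cong[THEN iffD1, rotated])
        fix x assume x: "x \<in> X"
        have comm: "?A (Suc j) x = ?A j x ** jacobian_on X G x"
          using matpow_add[of "jacobian_on X G x" j 1] by (simp only: matpow.simps One_nat_def
              add_Suc_right add_0_right matrix_mul_rid)
        have "jacobian_on X (\<lambda>y. ?R j y + (- c j) *\<^sub>R (?A j y *v G y)) x =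
            jacobian_on X (?R j) x + (- c j) *\<^sub>R jacobian_on X (\<lambda>x. ?A j x *v G x) x"
          by (rule jacobian_on_add_scaleR[OF X(2) x bigo_vec_differentiable[OF Rj x]
                bigo_vec_differentiable[OF AG x]])
        moreover have "(\<lambda>y. ?R j y + (- c j) *\<^sub>R (?A j y *v G y)) = g (2 * j + 1)" by auto
        ultimately have "jacobian_on X (g (2 * j + 1)) x =
            jacobian_on X (?R j) x + (- c j) *\<^sub>R jacobian_on X (\<lambda>x. ?A j x *v G x) x"
          by (simp only:)
        then show "jacobian_on X (?R j) x +
            (- c j) *\<^sub>R (jacobian_on X (\<lambda>x. ?A j x *v G x) x - ?A j x ** jacobian_on X G x) =
            jacobian_on X (g (2 * j + 1)) x + c j *\<^sub>R ?A (Suc j) x"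
          unfolding comm by (simp only: scaleR_diff_right) simp
      qed
      then show ?thesis using m(2) by (rule bigo_mat_mono) simp
    qed
    have g: "bigo_vec (r - k) 1 (g (2 * j + 1))" if j: "j < k" for j
    proof -
      have "bigo_mat (r - k) 0 (?A j)" using False by (intro A) auto
      from bigo_mat_vec_mult[OF this bigo_vec_mono[OF G]]
      have "bigo_vec (r - k) 1 (\<lambda>x. ?A j x *v G x)" by simp
      moreover have "bigo_vec (r - k) 1 (?R j)" using R[OF j] by (rule bigo_vec_mono) (use j in auto)
      ultimately have "bigo_vec (r - k) 1 (\<lambda>x. ?R j x + (- c j) *\<^sub>R (?A j x *v G x))"
        using bigo_vec_add bigo_vec_scaleR by blast
      then show ?thesis by simp
    qed
    \<comment> \<open>The Catalan convolution; starting from \<open>\<eta>\<close> it produces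
      \<open>\<eta> ^ (k + 1)\<close> times the Catalan numbers.\<close>
    define C where "C = (\<Sum>j<k. c j * c (k - 1 - j))"
    have "C > 0" unfolding C_def using c False by (intro sum_pos) auto
    let ?Q = "\<lambda>j x. jacobian_on X (g (2 * j + 1)) x + c j *\<^sub>R ?A (Suc j) x"
    \<comment> \<open>Substituting the leading terms first in the Jacobian and then in the vector,
      with \<open>b = k - 1 - j\<close>, splits each product into \<open>?Q j\<close> applied to
      \<open>g (2 * b + 1)\<close> (order 1 + 1), \<open>- c j\<close> times the matrix power
      applied to \<open>?R b\<close> (order 0 + 2), and the main term \<open>c j * c b\<close> times
      the power \<open>k\<close> applied to \<open>G\<close>.\<close>
    let ?S = "\<lambda>x. (- 1) *\<^sub>R (\<Sum>j<k. ?Q j x *v g (2 * (k - 1 - j) + 1) x +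
        (- c j) *\<^sub>R (?A (Suc j) x *v ?R (k - 1 - j) x))"
    have "bigo_vec (r - k) (1 + 1) (\<lambda>x. ?Q j x *v g (2 * (k - 1 - j) + 1) x)" if "j < k" for j
      using that by (intro bigo_mat_vec_mult Q g) auto
    moreover have "bigo_vec (r - k) (0 + 2) (\<lambda>x. ?A (Suc j) x *v ?R (k - 1 - j) x)" if "j < k" for j
    proof (rule bigo_mat_vec_mult)
      show "bigo_mat (r - k) 0 (?A (Suc j))" using False by (intro A) auto
      show "bigo_vec (r - k) 2 (?R (k - 1 - j))"
        by (rule bigo_vec_mono[OF R]) (use that in auto)
    qed
    ultimately have S: "bigo_vec (r - k) 2 ?S"
      by (intro bigo_vec_scaleR bigo_vec_sum bigo_vec_add) (auto simp: numeral_2_eq_2)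
    have "?S x = g (2 * k + 1) x + C *\<^sub>R (?A k x *v G x)" if x: "x \<in> X" for x
    proof -
      have "g (2 * k + 1) x = - (\<Sum>l = 1..2 * k - 1. jacobian_on X (g l) x *v g (2 * k - l) x)"
        using odd x False by simp
      also have "(\<Sum>l = 1..2 * k - 1. jacobian_on X (g l) x *v g (2 * k - l) x) =
          (\<Sum>j<k. jacobian_on X (g (2 * j + 1)) x *v g (2 * k - (2 * j + 1)) x)"
      proof (rule sum_odd_indices)
        fix j assume "1 \<le> j" "j < k"
        then have "g (2 * k - 2 * j) x = 0" using even[of "k - j" x] x by (simp add: diff_mult_distrib2)
        then show "jacobian_on X (g (2 * j)) x *v g (2 * k - 2 * j) x = 0" by simp
      qed
      also have "\<dots> = (\<Sum>j<k. ?Q j x *v g (2 * (k - 1 - j) + 1) x +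
          (- c j) *\<^sub>R (?A (Suc j) x *v ?R (k - 1 - j) x) + (c j * c (k - 1 - j)) *\<^sub>R (?A k x *v G x))"
      proof (rule sum.cong)
        fix j assume "j \<in> {..<k}"
        then have j: "j < k" by simp
        have idx: "2 * k - (2 * j + 1) = 2 * (k - 1 - j) + 1" using j by simp
        have "?A (Suc j) x ** ?A (k - 1 - j) x = ?A k x"
          using matpow_add[of "jacobian_on X G x" "Suc j" "k - 1 - j"] j by simp
        then have "?A (Suc j) x *v (?A (k - 1 - j) x *v G x) = ?A k x *v G x"
          by (simp only: matrix_vector_mul_assoc)
        then show "jacobian_on X (g (2 * j + 1)) x *v g (2 * k - (2 * j + 1)) x =
            ?Q j x *v g (2 * (k - 1 - j) + 1) x + (- c j) *\<^sub>R (?A (Suc j) x *v ?R (k - 1 - j) x) +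
            (c j * c (k - 1 - j)) *\<^sub>R (?A k x *v G x)"
          unfolding idx
          by (simp add: matrix_vector_mult_add_rdistrib matrix_vector_right_distrib
              matrix_vector_mult_scaleR scaleR_add_right del: matpow.simps flip: scaleR_matrix_vector_assoc)
      qed simp
      also have "\<dots> = (\<Sum>j<k. ?Q j x *v g (2 * (k - 1 - j) + 1) x +
          (- c j) *\<^sub>R (?A (Suc j) x *v ?R (k - 1 - j) x)) + C *\<^sub>R (?A k x *v G x)"
        by (simp only: sum.distrib C_def scaleR_left.sum)
      finally show ?thesis by simp
    qed
    then have "bigo_vec (r - k) 2 (\<lambda>x. g (2 * k + 1) x + C *\<^sub>R (?A k x *v G x))"
      using S by (rule bigo_vec_cong[THEN iffD1])
    then show ?thesis using \<open>C > 0\<close> by blast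
  qed
qed

end

section \<open>Stability of the minimiser\<close>

lemma Ck_on_imp_continuous_on: "Ck_on m X u \<Longrightarrow> continuous_on X u"
  by (cases m) (auto intro: differentiable_imp_continuous_on)

lemma continuous_on_vec_componentwise:
  assumes "\<And>i. continuous_on X (\<lambda>x. u x $ i)"
  shows "continuous_on X u"
proof -
  have "continuous_on X (\<lambda>x. \<chi> i. u x $ i)" using assms by (intro continuous_on_vec_lambda)
  then show ?thesis by simp
qed

theorem theorem2:
  fixes X :: "(real^'n) set" and f :: "real^'n \<Rightarrow> real" and xs :: "real^'n"
    and g :: "nat \<Rightarrow> real^'n \<Rightarrow> real^'n" and \<epsilon> \<eta> :: real and r p :: nat
  assumes "compact X" and "convex X"
    and "Ck_on (r + 1) X f" and "convex_on X f"
    and "xs \<in> X" and "\<And>x. x \<in> X \<Longrightarrow> x \<noteq> xs \<Longrightarrow> f xs < f x"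
    and "gradient_on X f xs = 0"
    and "\<epsilon> > 0" and "\<eta> > 0"
    and "\<And>x. x \<in> X \<Longrightarrow> g 1 x = - \<eta> *\<^sub>R gradient_on X f x"
    and "\<And>k x. k \<ge> 1 \<Longrightarrow> x \<in> X \<Longrightarrow> g (2 * k) x = 0"
    and "\<And>k x. k \<ge> 1 \<Longrightarrow> x \<in> X \<Longrightarrow>
           g (2 * k + 1) x = - (\<Sum>l = 1..2 * k - 1. jacobian_on X (g l) x *v g (2 * k - l) x)"
    and "p \<le> r"
  shows "fixed_point_on X (\<lambda>x. \<Sum>k = 0..p. \<epsilon> ^ (2 * k + 1) *\<^sub>R g (2 * k + 1) x) xs \<and>
    asymptotically_stable_on X (\<lambda>x. \<Sum>k = 0..p. \<epsilon> ^ (2 * k + 1) *\<^sub>R g (2 * k + 1) x) xs"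
proof -
  let ?F = "\<lambda>x. \<Sum>k = 0..p. \<epsilon> ^ (2 * k + 1) *\<^sub>R g (2 * k + 1) x"
  define G where "G = gradient_on X f"
  define H where "H = jacobian_on X G"
  have f: "f differentiable_on X" and Gi: "\<And>i. Ck_on r X (\<lambda>x. G x $ i)"
    using assms(3) by (auto simp: G_def)
  have fG: "(f has_derivative (\<lambda>h. G x \<bullet> h)) (at x within X)" if "x \<in> X" for x
    unfolding G_def using f that assms(2) by (intro gradient_on(2)) (auto simp: differentiable_on_def)
  have contG: "continuous_on X G"
    using Gi by (intro continuous_on_vec_componentwise Ck_on_imp_continuous_on)
  obtain W where W: "\<And>x. x \<in> X \<Longrightarrow> norm (G x) \<le> W"
    using compact_imp_bounded[OF compact_continuous_image[OF contG assms(1)]]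
    by (auto simp: bounded_iff)
  interpret bounded_weight X "\<lambda>x. norm (G x)" W
    by unfold_locales (use assms(1,2) W in auto)
  \<comment> \<open>Components of \<open>G\<close> are bounded by its norm; their derivatives need
    only be bounded, as the order has then dropped to 0.\<close>
  have "bigo_Dk X (\<lambda>x. norm (G x)) r 1 (\<lambda>x. G x $ i)" for i
  proof -
    have "\<forall>x\<in>X. \<bar>G x $ i\<bar> \<le> 1 * norm (G x) ^ 1" by (simp add: component_le_norm_cart)
    then have bound: "\<exists>K. \<forall>x\<in>X. \<bar>G x $ i\<bar> \<le> K * norm (G x) ^ 1" by blast
    show ?thesis
    proof (cases r)
      case 0
      then show ?thesis using bound by simp
    next
      case (Suc m)
      then have "bigo_Dk X (\<lambda>x. norm (G x)) m 0 (\<lambda>x. gradient_on X (\<lambda>x. G x $ i) x $ j)" for j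
        using Gi[of i] by (intro Ck_on_imp_bigo_Dk) auto
      then show ?thesis using bound Gi[of i] by (simp add: Suc)
    qed
  qed
  then have "bigo_vec r 1 G" by (simp add: bigo_vec_def)
  note expansion = slow_manifold_expansion[OF this \<open>\<eta> > 0\<close> assms(10)[folded G_def] assms(11,12), folded H_def]
  have "\<forall>k. \<exists>c. k \<le> p \<longrightarrow>
      c > 0 \<and> bigo_vec (r - k) 2 (\<lambda>x. g (2 * k + 1) x + c *\<^sub>R (matpow (H x) k *v G x))"
  proof
    fix k
    show "\<exists>c. k \<le> p \<longrightarrow>
        c > 0 \<and> bigo_vec (r - k) 2 (\<lambda>x. g (2 * k + 1) x + c *\<^sub>R (matpow (H x) k *v G x))"
      using expansion[of k] \<open>p \<le> r\<close> by (cases "k \<le> p") auto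
  qed
  from choice[OF this] obtain c where c: "\<And>k. k \<le> p \<Longrightarrow> c k > 0"
    and R: "\<And>k. k \<le> p \<Longrightarrow> bigo_vec (r - k) 2 (\<lambda>x. g (2 * k + 1) x + c k *\<^sub>R (matpow (H x) k *v G x))"
    by blast
  \<comment> \<open>The remainders of all summands together: quadratic in \<open>G\<close>, hence
    also 0 at \<open>xs\<close>.\<close>
  define S where "S x = (\<Sum>k = 0..p. \<epsilon> ^ (2 * k + 1) *\<^sub>R (g (2 * k + 1) x + c k *\<^sub>R (matpow (H x) k *v G x)))" for x
  have "bigo_vec (r - p) 2 S"
    unfolding S_def by (intro bigo_vec_sum bigo_vec_scaleR bigo_vec_mono[OF R]) auto
  from bigo_vec_bound[OF this] obtain K where K: "\<And>x. x \<in> X \<Longrightarrow> norm (S x) \<le> K * norm (G x) ^ 2"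
    by blast
  have F_eq: "?F x = S x - (\<Sum>k = 0..p. (\<epsilon> ^ (2 * k + 1) * c k) *\<^sub>R (matpow (H x) k *v G x))" for x
    by (simp add: S_def scaleR_add_right sum.distrib)
  have "S xs = 0" using K[OF \<open>xs \<in> X\<close>] assms(7) by (simp add: G_def)
  then have fixed: "fixed_point_on X ?F xs"
    using assms(5,7) F_eq[of xs] by (simp add: fixed_point_on_def G_def)
  \<comment> \<open>The power 0 gives a square. A positive \<open>k\<close> forces
    \<open>r \<ge> 1\<close>, so that the Hessian exists and is continuous.\<close>
  have matpow: "0 \<le> G x \<bullet> (matpow (H x) k *v G x)" if x: "x \<in> X" and k: "k \<le> p" for x k
  proof (cases "k = 0")
    case False
    then obtain m where r: "r = Suc m" using k \<open>p \<le> r\<close> by (cases r) auto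
    have dG: "G differentiable (at y within X)" if "y \<in> X" for y
      using Gi that unfolding r
      by (intro differentiable_vec_componentwise) (auto simp: differentiable_on_def)
    have "continuous_on X (\<lambda>y. H y $ i $ j)" for i j
    proof -
      have "continuous_on X (\<lambda>y. gradient_on X (\<lambda>y. G y $ i) y $ j)"
        using Gi[of i] unfolding r by (auto intro: Ck_on_imp_continuous_on)
      then show ?thesis
        using jacobian_on_nth[OF assms(2) _ dG] by (simp add: H_def cong: continuous_on_cong)
    qed
    then have "continuous_on X H" by (intro continuous_on_vec_componentwise)
    then show ?thesis
      using hessian_on_symmetric[OF assms(2) x f] hessian_on_nonneg[OF assms(2) x f assms(4)] dG x
      unfolding H_def G_def by (intro matpow_nonneg) (auto simp: differentiable_on_def)
  qed simp
  \<comment> \<open>The coefficient of the summand \<open>k = 0\<close>, the only main term that the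
    estimate keeps; the others have the favourable sign.\<close>
  define b where "b = \<epsilon> * c 0"
  have b: "b > 0" using c[of 0] \<open>\<epsilon> > 0\<close> by (simp add: b_def)
  have GF: "G x \<bullet> ?F x \<le> K * norm (G x) ^ 3 - b * norm (G x) ^ 2" if x: "x \<in> X" for x
  proof -
    let ?T = "\<lambda>k. (\<epsilon> ^ (2 * k + 1) * c k) * (G x \<bullet> (matpow (H x) k *v G x))"
    have "?T 0 \<le> (\<Sum>k = 0..p. ?T k)"
      using c \<open>\<epsilon> > 0\<close> matpow[OF x] by (intro member_le_sum) (auto simp: less_imp_le)
    moreover have "G x \<bullet> S x \<le> norm (G x) * (K * norm (G x) ^ 2)"
      using K[OF x] by (intro order_trans[OF norm_cauchy_schwarz] mult_left_mono) auto
    moreover have "G x \<bullet> ?F x = G x \<bullet> S x - (\<Sum>k = 0..p. ?T k)"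
      unfolding F_eq by (simp add: inner_diff_right inner_sum_right)
    moreover have "?T 0 = b * norm (G x) ^ 2" by (simp add: b_def power2_norm_eq_inner)
    ultimately show ?thesis by (simp add: power3_eq_cube power2_eq_square mult_ac)
  qed
  \<comment> \<open>For gradients shorter than this the cubic error takes at most half of the
    quadratic decay; the summand 1 covers \<open>K = 0\<close>.\<close>
  define \<delta> where "\<delta> = b / (2 * (\<bar>K\<bar> + 1))"
  have "\<delta> > 0" using b by (simp add: \<delta>_def)
  then obtain \<rho> where \<rho>: "\<rho> > 0" "\<And>x. x \<in> X \<Longrightarrow> dist x xs < \<rho> \<Longrightarrow> norm (G x) < \<delta>"
    using contG \<open>xs \<in> X\<close> assms(7) unfolding continuous_on_iff G_def by (metis dist_0_norm dist_commute)
  have "asymptotically_stable_on X ?F xs"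
  proof (rule asymptotically_stable_onI[OF \<open>compact X\<close> \<open>xs \<in> X\<close> fG assms(6)])
    show "continuous_on X (\<lambda>x. b / 2 * norm (G x) ^ 2)"
      by (intro continuous_intros contG)
    show "b / 2 * norm (G x) ^ 2 > 0" if "x \<in> X" "x \<noteq> xs" for x
    proof -
      \<comment> \<open>The gradient inequality at \<open>x\<close>, towards the strict minimiser:
        no other point of \<open>X\<close> is critical.\<close>
      have "G x \<bullet> (xs - x) < 0"
        using convex_on_gradient_inequality[OF assms(4) that(1) \<open>xs \<in> X\<close> fG[OF that(1)]]
          assms(6)[OF that] by simp
      then have "G x \<noteq> 0" by auto
      then show ?thesis using b by simp
    qed
    show "G x \<bullet> ?F x \<le> - (b / 2 * norm (G x) ^ 2)" if "x \<in> X" "dist x xs < \<rho>" for x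
    proof -
      have "K * norm (G x) \<le> (\<bar>K\<bar> + 1) * norm (G x)" by (intro mult_right_mono) auto
      also have "\<dots> \<le> (\<bar>K\<bar> + 1) * \<delta>"
        using \<rho>(2)[OF that] by (intro mult_left_mono) auto
      also have "\<dots> = b / 2" by (simp add: \<delta>_def divide_simps)
      finally have "K * norm (G x) * norm (G x) ^ 2 \<le> b / 2 * norm (G x) ^ 2"
        by (intro mult_right_mono) auto
      then show ?thesis using GF[OF that(1)] by (simp add: power3_eq_cube power2_eq_square)
    qed
  qed (use b \<rho> in auto)
  with fixed show ?thesis by blast
qed

end
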